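(* Let $k,m,n\ge 1$ be integers and let $A\in\{0,1\}^{m\times n}$ be a random data matrix drawn from the mixture of $k$ discrete distributions described in the context, with means $\mu_1,\dots,\mu_k\in[0,1]^n$, weights $w_1,\dots,w_k$, $w_{\min}=\min_r w_r$, separation $\Delta_\mu=\min_{r\ne s}\|\mu_r-\mu_s\|_2$, and a number $\sigma^2>0$ with $\mu_{r,j}\le\sigma^2$ for all $r\in[k]$, $j\in[n]$. Suppose that the data and parameters satisfy $$\|A-\mathbb{E}[A]\|^2\le\frac{0.01\,w_{\min}\,m\,\Delta_\mu^2}{50k},\qquad m\sigma^2\gtrsim 1,\qquad \Delta_\mu\ge\tilde\Omega\Big(\sqrt{\sigma^2/w_{\min}}\Big).$$ Then the algorithm Clustering (defined in the context), run on input $A$, achieves exact clustering of $A$ with high probability; that is, its output $\hat{\mathcal C}:[m]\to[k]$ equals the true labeling $\mathcal C$ up to a permutation of the label set $[k]$. Explicitly: for all constants $C,c_0>0$ there is a constant $K=K(C,c_0)$ such that whenever $m\sigma^2\ge c_0$ and $\Delta_\mu\ge K\log^{K}(m+n+1)\sqrt{\sigma^2/w_{\min}}$, the probability that $\|A-\mathbb{E}[A]\|^2\le 0.01\,w_{\min}m\Delta_\mu^2/(50k)$ holds and $\hat{\mathcal C}$ does not equal $\mathcal C$ up to a permutation of labels is at most $K m^{-C}$.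
   Context: Model. There are $k$ distributions $D_1,\dots,D_k$ on $\{0,1\}^n$ with means $\mu_1,\dots,\mu_k\in[0,1]^n$: a sample $a\sim D_r$ has independent coordinates $a_j\sim\mathrm{Bernoulli}(\mu_{r,j})$. There is a true labeling $\mathcal C:[m]\to[k]$ with clusters $U_r=\mathcal C^{-1}(r)$, $|U_r|=w_r m$, $w_r>0$, $\sum_r w_r=1$. The rows $A(1),\dots,A(m)$ of $A$ are independent with $A(i)\sim D_{\mathcal C(i)}$, so the $i$-th row of $\mathbb{E}[A]$ is $\mu_{\mathcal C(i)}$. $\|\cdot\|$ applied to a matrix is the spectral norm. The symbols $\lesssim,\gtrsim$ hide constant factors, $\tilde O,\tilde\Omega$ hide factors polylogarithmic in $m,n$, and "with high probability" means with probability at least $1-O(m^{-C})$ for a large constant $C$. Procedure Centers. Input: a binary matrix $B$ with $n$ columns. Let $B^{(k)}$ be its best rank-$k$ approximation (truncated $k$-SVD). Apply $k$-means to the rows of $B^{(k)}$, i.e. find a partition of the row indices into clusters $\hat U_1,\dots,\hat U_k$ minimizing the sum of squared Euclidean distances of the rows of $B^{(k)}$ to the mean of the rows of $B^{(k)}$ in their cluster. Output $\hat\mu_r=\frac{1}{|\hat U_r|}\sum_{i\in\hat U_r}B(i)$, $1\le r\le k$ (averages of rows of the original matrix $B$). Procedure Assignment. Input: a binary matrix $B$ with $n$ columns and vectors $\hat\mu_1,\dots,\hat\mu_k$. Output: the labeling $i\mapsto\arg\min_{r\in[k]}\|B(i)-\hat\mu_r\|_2$. Algorithm Clustering. Input: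 $A\in\{0,1\}^{m\times n}$. (1) Split (the rows of) $A$ into two subsets $A_1,A_2$ of the same size. (2) Run Centers on $A_1$ and use the resulting centers in Assignment to label the rows of $A_2$. (3) Run Centers on $A_2$ and use the resulting centers in Assignment to label the rows of $A_1$. (4) Match the labels used for $A_2$ and $A_1$ by matching the two sets of estimated centers (each center of one set with the nearest center of the other). (5) Output the combined labeling $\hat{\mathcal C}:[m]\to[k]$.
   Formalization: The split in step (1) is fixed before the data are drawn (sizes may differ by one) and is assumed to put at least a quarter of each true cluster in each half; without such a condition the claim fails, e.g. when a cluster has a single row. *)

theory Defs
  imports "HOL-Probability.Probability"
begin

text \<open>
  The dimensions \<open>m\<close>, \<open>n\<close> and \<open>k\<close> vary within the theorem, so a matrix is a function
  \<^typ>\<open>nat \<Rightarrow> nat \<Rightarrow> real\<close> together with a finite set \<open>R\<close> of row indices and the column indices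
  \<open>{..<n}\<close>. Entries outside these index sets carry no meaning. Labels range over \<open>{..<k}\<close>.
\<close>

section \<open>The mixture model\<close>

definition row_dist :: "nat \<Rightarrow> (nat \<Rightarrow> real) \<Rightarrow> (nat \<Rightarrow> bool) pmf" where
  "row_dist n \<mu> = Pi_pmf {..<n} False (\<lambda>j. bernoulli_pmf (\<mu> j))"

definition mixture_data ::
  "nat \<Rightarrow> nat \<Rightarrow> (nat \<Rightarrow> nat) \<Rightarrow> (nat \<Rightarrow> nat \<Rightarrow> real) \<Rightarrow> (nat \<Rightarrow> nat \<Rightarrow> bool) pmf" where
  "mixture_data m n c \<mu> = Pi_pmf {..<m} (\<lambda>_. False) (\<lambda>i. row_dist n (\<mu> (c i)))"

definition real_matrix :: "(nat \<Rightarrow> nat \<Rightarrow> bool) \<Rightarrow> nat \<Rightarrow> nat \<Rightarrow> real" where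
  "real_matrix A i j = of_bool (A i j)"

definition mean_matrix :: "(nat \<Rightarrow> nat \<Rightarrow> bool) pmf \<Rightarrow> nat \<Rightarrow> nat \<Rightarrow> real" where
  "mean_matrix p i j = measure_pmf.expectation p (\<lambda>A. real_matrix A i j)"

definition cluster :: "nat \<Rightarrow> (nat \<Rightarrow> nat) \<Rightarrow> nat \<Rightarrow> nat set" where
  "cluster m c r = {i. i < m \<and> c i = r}"

definition weight :: "nat \<Rightarrow> (nat \<Rightarrow> nat) \<Rightarrow> nat \<Rightarrow> real" where
  "weight m c r = real (card (cluster m c r)) / real m"

definition min_weight :: "nat \<Rightarrow> nat \<Rightarrow> (nat \<Rightarrow> nat) \<Rightarrow> real" where
  "min_weight k m c = Min (weight m c ` {..<k})"

definition vec_dist :: "nat \<Rightarrow> (nat \<Rightarrow> real) \<Rightarrow> (nat \<Rightarrow> real) \<Rightarrow> real" where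
  "vec_dist n x y = L2_set (\<lambda>j. x j - y j) {..<n}"

text \<open>Only meaningful for \<open>k \<ge> 2\<close>; otherwise the minimum is over the empty set.\<close>

definition separation :: "nat \<Rightarrow> nat \<Rightarrow> (nat \<Rightarrow> nat \<Rightarrow> real) \<Rightarrow> real" where
  "separation k n \<mu> = Min {vec_dist n (\<mu> r) (\<mu> s) | r s. r < k \<and> s < k \<and> r \<noteq> s}"

definition spectral_norm :: "nat set \<Rightarrow> nat \<Rightarrow> (nat \<Rightarrow> nat \<Rightarrow> real) \<Rightarrow> real" where
  "spectral_norm R n X =
     (SUP x \<in> {x. L2_set x {..<n} \<le> 1}. L2_set (\<lambda>i. \<Sum>j<n. X i j * x j) R)"

section \<open>Truncated singular value decomposition and k-means\<close>

definition orthonormal_fam :: "'i set \<Rightarrow> nat \<Rightarrow> (nat \<Rightarrow> 'i \<Rightarrow> real) \<Rightarrow> bool" where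
  "orthonormal_fam I p u \<longleftrightarrow>
     (\<forall>l<p. \<forall>l'<p. (\<Sum>i\<in>I. u l i * u l' i) = (if l = l' then 1 else 0))"

definition is_svd ::
  "nat set \<Rightarrow> nat \<Rightarrow> (nat \<Rightarrow> nat \<Rightarrow> real) \<Rightarrow>
   nat \<Rightarrow> (nat \<Rightarrow> real) \<Rightarrow> (nat \<Rightarrow> nat \<Rightarrow> real) \<Rightarrow> (nat \<Rightarrow> nat \<Rightarrow> real) \<Rightarrow> bool" where
  "is_svd R n X p s u v \<longleftrightarrow>
     orthonormal_fam R p u \<and> orthonormal_fam {..<n} p v \<and>
     (\<forall>l<p. 0 \<le> s l) \<and> (\<forall>l<p. \<forall>l'<p. l \<le> l' \<longrightarrow> s l' \<le> s l) \<and>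
     (\<forall>i\<in>R. \<forall>j<n. X i j = (\<Sum>l<p. s l * u l i * v l j))"

text \<open>
  By Eckart-Young, the following matrices are the best rank-\<open>k\<close> approximations of \<open>X\<close> (in
  Frobenius norm). There is more than one if the \<open>k\<close>-th and the following singular value coincide.
\<close>

definition is_truncated_svd ::
  "nat \<Rightarrow> nat set \<Rightarrow> nat \<Rightarrow> (nat \<Rightarrow> nat \<Rightarrow> real) \<Rightarrow> (nat \<Rightarrow> nat \<Rightarrow> real) \<Rightarrow> bool" where
  "is_truncated_svd k R n X M \<longleftrightarrow>
     (\<exists>p s u v. is_svd R n X p s u v \<and>
        (\<forall>i\<in>R. \<forall>j<n. M i j = (\<Sum>l<min k p. s l * u l i * v l j)))"

text \<open>Because of \<open>x / 0 = 0\<close>, the mean over the empty set is \<open>0\<close>.\<close>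

definition row_mean :: "nat set \<Rightarrow> (nat \<Rightarrow> nat \<Rightarrow> real) \<Rightarrow> nat \<Rightarrow> real" where
  "row_mean U X j = (\<Sum>i\<in>U. X i j) / real (card U)"

definition label_class :: "nat set \<Rightarrow> (nat \<Rightarrow> nat) \<Rightarrow> nat \<Rightarrow> nat set" where
  "label_class R lab r = {i \<in> R. lab i = r}"

definition kmeans_cost ::
  "nat \<Rightarrow> nat set \<Rightarrow> nat \<Rightarrow> (nat \<Rightarrow> nat \<Rightarrow> real) \<Rightarrow> (nat \<Rightarrow> nat) \<Rightarrow> real" where
  "kmeans_cost k R n X lab =
     (\<Sum>r<k. \<Sum>i\<in>label_class R lab r. (vec_dist n (X i) (row_mean (label_class R lab r) X))\<^sup>2)"

definition is_kmeans ::
  "nat \<Rightarrow> nat set \<Rightarrow> nat \<Rightarrow> (nat \<Rightarrow> nat \<Rightarrow> real) \<Rightarrow> (nat \<Rightarrow> nat) \<Rightarrow> bool" where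
  "is_kmeans k R n X lab \<longleftrightarrow>
     is_arg_min (kmeans_cost k R n X) (\<lambda>l. \<forall>i\<in>R. l i < k) lab"

section \<open>The algorithm\<close>

text \<open>
  \<open>is_centers k n R B ctr\<close>: the vectors \<open>ctr 0, \<dots>, ctr (k - 1)\<close> are a possible output of
  Centers on the rows \<open>R\<close> of the binary matrix \<open>B\<close>. The clusters are found from the truncated
  SVD, but the averages are taken over rows of \<open>B\<close> itself.
\<close>

definition is_centers ::
  "nat \<Rightarrow> nat \<Rightarrow> nat set \<Rightarrow> (nat \<Rightarrow> nat \<Rightarrow> bool) \<Rightarrow> (nat \<Rightarrow> nat \<Rightarrow> real) \<Rightarrow> bool" where
  "is_centers k n R B ctr \<longleftrightarrow>
     (\<exists>M lab. is_truncated_svd k R n (real_matrix B) M \<and> is_kmeans k R n M lab \<and>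
        (\<forall>r<k. \<forall>j<n. ctr r j = row_mean (label_class R lab r) (real_matrix B) j))"

text \<open>
  The SVD and the k-means optimum need not be unique. An implementation of Centers is a function
  that resolves all such choices in an arbitrary way; by the second clause it sees only the rows
  \<open>R\<close> and the first \<open>n\<close> columns of its matrix argument, so that the centers computed from one half
  of the data do not depend on the other half.
\<close>

definition centers_procedure ::
  "nat \<Rightarrow> nat \<Rightarrow> (nat set \<Rightarrow> (nat \<Rightarrow> nat \<Rightarrow> bool) \<Rightarrow> nat \<Rightarrow> nat \<Rightarrow> real) \<Rightarrow> bool" where
  "centers_procedure k n centers \<longleftrightarrow>
     (\<forall>R B. finite R \<longrightarrow> is_centers k n R B (centers R B)) \<and>
     (\<forall>R B B'. (\<forall>i\<in>R. \<forall>j<n. B i j = B' i j) \<longrightarrow>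
        (\<forall>r<k. \<forall>j<n. centers R B r j = centers R B' r j))"

definition is_assignment ::
  "nat \<Rightarrow> nat \<Rightarrow> nat set \<Rightarrow> (nat \<Rightarrow> nat \<Rightarrow> bool) \<Rightarrow> (nat \<Rightarrow> nat \<Rightarrow> real) \<Rightarrow> (nat \<Rightarrow> nat) \<Rightarrow> bool" where
  "is_assignment k n R B ctr lab \<longleftrightarrow>
     (\<forall>i\<in>R. is_arg_min (\<lambda>r. vec_dist n (real_matrix B i) (ctr r)) (\<lambda>r. r < k) (lab i))"

definition is_matching ::
  "nat \<Rightarrow> nat \<Rightarrow> (nat \<Rightarrow> nat \<Rightarrow> real) \<Rightarrow> (nat \<Rightarrow> nat \<Rightarrow> real) \<Rightarrow> (nat \<Rightarrow> nat) \<Rightarrow> bool" where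
  "is_matching k n ctr ctr' \<tau> \<longleftrightarrow>
     (\<forall>r<k. is_arg_min (\<lambda>s. vec_dist n (ctr r) (ctr' s)) (\<lambda>s. s < k) (\<tau> r))"

text \<open>
  \<open>lab\<^sub>2\<close> labels the rows \<open>S\<^sub>2\<close> by indices of the centers of \<open>S\<^sub>1\<close>, and \<open>lab\<^sub>1\<close> the rows \<open>S\<^sub>1\<close> by
  indices of the centers of \<open>S\<^sub>2\<close>; \<open>\<tau>\<close> translates the former indices into the latter.
\<close>

definition clustering_output ::
  "nat \<Rightarrow> nat \<Rightarrow> (nat set \<Rightarrow> (nat \<Rightarrow> nat \<Rightarrow> bool) \<Rightarrow> nat \<Rightarrow> nat \<Rightarrow> real) \<Rightarrow>
   nat set \<Rightarrow> nat set \<Rightarrow> (nat \<Rightarrow> nat \<Rightarrow> bool) \<Rightarrow> (nat \<Rightarrow> nat) \<Rightarrow> bool" where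
  "clustering_output k n centers S\<^sub>1 S\<^sub>2 A out \<longleftrightarrow>
     (\<exists>lab\<^sub>1 lab\<^sub>2 \<tau>.
        is_assignment k n S\<^sub>2 A (centers S\<^sub>1 A) lab\<^sub>2 \<and>
        is_assignment k n S\<^sub>1 A (centers S\<^sub>2 A) lab\<^sub>1 \<and>
        is_matching k n (centers S\<^sub>1 A) (centers S\<^sub>2 A) \<tau> \<and>
        (\<forall>i\<in>S\<^sub>1. out i = lab\<^sub>1 i) \<and> (\<forall>i\<in>S\<^sub>2. out i = \<tau> (lab\<^sub>2 i)))"

definition equal_up_to_perm :: "nat \<Rightarrow> nat \<Rightarrow> (nat \<Rightarrow> nat) \<Rightarrow> (nat \<Rightarrow> nat) \<Rightarrow> bool" where
  "equal_up_to_perm k m out c \<longleftrightarrow>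
     (\<exists>\<pi>. bij_betw \<pi> {..<k} {..<k} \<and> (\<forall>i<m. out i = \<pi> (c i)))"

section \<open>The split of the rows\<close>

text \<open>If \<open>m\<close> is odd, the two parts have sizes differing by one.\<close>

definition equal_split :: "nat \<Rightarrow> nat set \<Rightarrow> nat set \<Rightarrow> bool" where
  "equal_split m S\<^sub>1 S\<^sub>2 \<longleftrightarrow>
     S\<^sub>1 \<union> S\<^sub>2 = {..<m} \<and> S\<^sub>1 \<inter> S\<^sub>2 = {} \<and> card S\<^sub>1 \<le> card S\<^sub>2 + 1 \<and> card S\<^sub>2 \<le> card S\<^sub>1 + 1"

text \<open>
  Both halves have to be samples of the same mixture with comparable weights: if a cluster is
  missing from one half, the centers of that half cannot be used to label the other. A uniformly
  random split into equal halves puts about half of each cluster, up to fluctuations, into each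
  part; the condition asks for a quarter.
\<close>

definition representative_split ::
  "nat \<Rightarrow> nat \<Rightarrow> (nat \<Rightarrow> nat) \<Rightarrow> nat set \<Rightarrow> nat set \<Rightarrow> bool" where
  "representative_split k m c S\<^sub>1 S\<^sub>2 \<longleftrightarrow>
     (\<forall>r<k. real (card (cluster m c r)) / 4 \<le> real (card (cluster m c r \<inter> S\<^sub>1)) \<and>
            real (card (cluster m c r)) / 4 \<le> real (card (cluster m c r \<inter> S\<^sub>2)))"

end

theory Submission
  imports Defs
begin

text \<open>
  Let \<open>P\<close> project onto the leading right singular vectors of one half \<open>B\<close> of the data, \<open>Y\<close> be the
  matrix of true means and \<open>E = B - Y\<close>. The truncated SVD is \<open>BP\<close>, and the splitting
  \<open>BP - Y = EP - Y(I - P)\<close> is orthogonal. Its first part has squared Frobenius norm at most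
  \<open>k\<parallel>E\<parallel>\<^sup>2\<close>; its second part has rank at most \<open>k\<close> and operator norm at most \<open>2\<parallel>E\<parallel>\<close>, because
  \<open>Y(I - P) = B(I - P) - E(I - P)\<close> and the singular values of \<open>B\<close> beyond the \<open>k\<close>-th are at most
  \<open>\<parallel>E\<parallel>\<close>. Thus \<open>\<parallel>BP - Y\<parallel>\<^sub>F\<^sup>2 \<le> 5k\<parallel>E\<parallel>\<^sup>2\<close>, so the k-means partition misclassifies a small fraction of
  each cluster and every estimated center is within \<open>0.24 \<Delta>\<close> of its own mean.

  A row \<open>A(i)\<close> of the other half is independent of these centers. It is misassigned only if
  \<open>A(i) - \<mu>\<close> has a large inner product with the difference of two centers. The entries of the centers
  are of order \<open>log (m + n) \<sigma>\<^sup>2 / w\<^sub>m\<^sub>i\<^sub>n\<close>, since the column sums of \<open>A\<close> are \<open>O(m \<sigma>\<^sup>2 log (m + n))\<close>, so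
  a Bernstein-type bound makes this polynomially unlikely. A union bound over rows and pairs of
  labels finishes the proof.
\<close>

section \<open>Orthonormal families\<close>

lemma sum_orthonormal_mult:
  fixes u :: "nat \<Rightarrow> 'i \<Rightarrow> real"
  assumes "orthonormal_fam I p u" "T \<subseteq> {..<p}" "l' < p"
  shows "(\<Sum>i\<in>I. (\<Sum>l\<in>T. a l * u l i) * u l' i) = (if l' \<in> T then a l' else 0)"
proof -
  have fT: "finite T" using assms(2) finite_subset by blast
  have "(\<Sum>i\<in>I. (\<Sum>l\<in>T. a l * u l i) * u l' i) = (\<Sum>i\<in>I. \<Sum>l\<in>T. a l * (u l i * u l' i))"
    by (simp add: sum_distrib_right mult.assoc)
  also have "\<dots> = (\<Sum>l\<in>T. a l * (\<Sum>i\<in>I. u l i * u l' i))"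
    by (subst sum.swap) (simp add: sum_distrib_left)
  also have "\<dots> = (\<Sum>l\<in>T. if l = l' then a l else 0)"
    using assms by (intro sum.cong) (auto simp: orthonormal_fam_def)
  finally show ?thesis using fT by (simp add: sum.delta)
qed

lemma sum_orthonormal_sq:
  fixes u :: "nat \<Rightarrow> 'i \<Rightarrow> real"
  assumes "orthonormal_fam I p u" "T \<subseteq> {..<p}"
  shows "(\<Sum>i\<in>I. (\<Sum>l\<in>T. a l * u l i)\<^sup>2) = (\<Sum>l\<in>T. (a l)\<^sup>2)"
proof -
  have "(\<Sum>i\<in>I. (\<Sum>l\<in>T. a l * u l i)\<^sup>2)
      = (\<Sum>i\<in>I. \<Sum>l'\<in>T. a l' * ((\<Sum>l\<in>T. a l * u l i) * u l' i))"
    unfolding power2_eq_square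
    by (intro sum.cong refl) (simp add: sum_distrib_left mult_ac)
  also have "\<dots> = (\<Sum>l'\<in>T. a l' * (\<Sum>i\<in>I. (\<Sum>l\<in>T. a l * u l i) * u l' i))"
    by (subst sum.swap) (simp add: sum_distrib_left)
  also have "\<dots> = (\<Sum>l'\<in>T. (a l')\<^sup>2)"
    using assms(2)
    by (intro sum.cong refl, subst sum_orthonormal_mult[OF assms]) (auto simp: power2_eq_square)
  finally show ?thesis .
qed

text \<open>For an orthonormal family this is the orthogonal projection onto the span of its first
  \<open>q\<close> members. It serves both the singular vectors and the Gram-Schmidt bases
  below.\<close>

definition orth_proj :: "'i set \<Rightarrow> nat \<Rightarrow> (nat \<Rightarrow> 'i \<Rightarrow> real) \<Rightarrow> ('i \<Rightarrow> real) \<Rightarrow> 'i \<Rightarrow> real" where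
  "orth_proj I q v x j = (\<Sum>l<q. (\<Sum>i\<in>I. x i * v l i) * v l j)"

lemma orthonormal_fam_mono: "orthonormal_fam I p u \<Longrightarrow> q \<le> p \<Longrightarrow> orthonormal_fam I q u"
  unfolding orthonormal_fam_def by auto

lemma orth_proj_inner:
  assumes "orthonormal_fam I q v" "l < q"
  shows "(\<Sum>i\<in>I. orth_proj I q v x i * v l i) = (\<Sum>i\<in>I. x i * v l i)"
  unfolding orth_proj_def using assms by (subst sum_orthonormal_mult[OF assms(1)]) auto

lemma orth_proj_self_adjoint:
  "(\<Sum>i\<in>I. orth_proj I q v x i * y i) = (\<Sum>i\<in>I. x i * orth_proj I q v y i)"
proof -
  have "(\<Sum>i\<in>I. orth_proj I q v x i * y i) = (\<Sum>l<q. (\<Sum>i\<in>I. x i * v l i) * (\<Sum>i\<in>I. y i * v l i))"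
    for x y
  proof -
    have "(\<Sum>i\<in>I. orth_proj I q v x i * y i)
        = (\<Sum>i\<in>I. \<Sum>l<q. (\<Sum>i\<in>I. x i * v l i) * (y i * v l i))"
      unfolding orth_proj_def
      by (intro sum.cong refl, subst sum_distrib_right) (simp add: mult_ac)
    also have "\<dots> = (\<Sum>l<q. (\<Sum>i\<in>I. x i * v l i) * (\<Sum>i\<in>I. y i * v l i))"
      by (subst sum.swap) (simp flip: sum_distrib_left)
    finally show ?thesis .
  qed
  from this[of x y] this[of y x] show ?thesis by (simp add: mult_ac)
qed

lemma orth_proj_residual_inner:
  assumes "orthonormal_fam I q v"
  shows "(\<Sum>i\<in>I. (x i - orth_proj I q v x i) * (\<Sum>l<q. a l * v l i)) = 0"
proof -
  have "(\<Sum>i\<in>I. (x i - orth_proj I q v x i) * (\<Sum>l<q. a l * v l i))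
      = (\<Sum>l<q. a l * (\<Sum>i\<in>I. (x i - orth_proj I q v x i) * v l i))"
    unfolding sum_distrib_left by (subst sum.swap) (simp add: mult_ac)
  also have "\<dots> = 0"
    using orth_proj_inner[OF assms] by (simp add: left_diff_distrib sum_subtractf)
  finally show ?thesis .
qed

text \<open>A vector of the span is orthogonal to every residual of the projection. The coefficients
  \<open>a\<close> are independent of \<open>x\<close> because later they come from the projected
  noise while \<open>x\<close> is a true mean; the minus sign matches that decomposition.\<close>

lemma orthonormal_pythagoras:
  assumes "orthonormal_fam I q v"
  shows "(\<Sum>i\<in>I. ((\<Sum>l<q. a l * v l i) - (x i - orth_proj I q v x i))\<^sup>2)
       = (\<Sum>l<q. (a l)\<^sup>2) + (\<Sum>i\<in>I. (x i - orth_proj I q v x i)\<^sup>2)"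
proof -
  have "(\<Sum>i\<in>I. ((\<Sum>l<q. a l * v l i) - (x i - orth_proj I q v x i))\<^sup>2)
     = (\<Sum>i\<in>I. (\<Sum>l<q. a l * v l i)\<^sup>2) + (\<Sum>i\<in>I. (x i - orth_proj I q v x i)\<^sup>2)
       - 2 * (\<Sum>i\<in>I. (x i - orth_proj I q v x i) * (\<Sum>l<q. a l * v l i))"
    unfolding power2_diff sum.distrib sum_subtractf by (simp add: sum_distrib_left mult_ac)
  then show ?thesis
    using sum_orthonormal_sq[OF assms, of "{..<q}" a] orth_proj_residual_inner[OF assms] by simp
qed

lemma orth_proj_residual_sq:
  assumes "orthonormal_fam I q v"
  shows "(\<Sum>i\<in>I. (x i)\<^sup>2) = (\<Sum>l<q. (\<Sum>i\<in>I. x i * v l i)\<^sup>2) + (\<Sum>i\<in>I. (x i - orth_proj I q v x i)\<^sup>2)"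
proof -
  have "(\<Sum>i\<in>I. (x i)\<^sup>2)
     = (\<Sum>i\<in>I. ((\<Sum>l<q. - (\<Sum>i\<in>I. x i * v l i) * v l i) - (x i - orth_proj I q v x i))\<^sup>2)"
    by (simp add: orth_proj_def sum_negf)
  then show ?thesis
    using orthonormal_pythagoras[OF assms, of "\<lambda>l. - (\<Sum>i\<in>I. x i * v l i)" x] by simp
qed

lemma bessel_inequality:
  assumes "orthonormal_fam I q v"
  shows "(\<Sum>l<q. (\<Sum>i\<in>I. x i * v l i)\<^sup>2) \<le> (\<Sum>i\<in>I. (x i)\<^sup>2)"
  using orth_proj_residual_sq[OF assms, of x] by (simp add: sum_nonneg)

lemma orth_proj_residual_sq_le:
  assumes "orthonormal_fam I q v"
  shows "(\<Sum>i\<in>I. (x i - orth_proj I q v x i)\<^sup>2) \<le> (\<Sum>i\<in>I. (x i)\<^sup>2)"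
  using orth_proj_residual_sq[OF assms, of x] by (simp add: sum_nonneg)

lemma parseval_of_orth_proj_eq:
  assumes "orthonormal_fam I q v" "\<And>i. i \<in> I \<Longrightarrow> orth_proj I q v x i = x i"
  shows "(\<Sum>i\<in>I. (x i)\<^sup>2) = (\<Sum>l<q. (\<Sum>i\<in>I. x i * v l i)\<^sup>2)"
  using orth_proj_residual_sq[OF assms(1), of x] assms(2) by simp

text \<open>The vectors may be dependent, so \<open>q\<close> can be smaller than \<open>k\<close>:
  a step adds a basis vector only if its residual is nonzero. Membership in the span is stated as
  invariance under the projection, the form that Parseval's identity takes as input.\<close>

lemma gram_schmidt:
  fixes f :: "nat \<Rightarrow> 'i \<Rightarrow> real"
  assumes "finite I"
  obtains q v where "q \<le> k" "orthonormal_fam I q v"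
    "\<And>r i. r < k \<Longrightarrow> i \<in> I \<Longrightarrow> orth_proj I q v (f r) i = f r i"
proof -
  have "\<exists>q v. q \<le> k \<and> orthonormal_fam I q v \<and>
      (\<forall>r<k. \<forall>i\<in>I. orth_proj I q v (f r) i = f r i)"
  proof (induction k)
    case 0
    show ?case by (rule exI[of _ 0]) (auto simp: orthonormal_fam_def)
  next
    case (Suc k)
    then obtain q v where q: "q \<le> k" "orthonormal_fam I q v"
      "\<forall>r<k. \<forall>i\<in>I. orth_proj I q v (f r) i = f r i" by blast
    define z where "z i = f k i - orth_proj I q v (f k) i" for i
    define Z where "Z = (\<Sum>i\<in>I. (z i)\<^sup>2)"
    show ?case
    proof (cases "Z = 0")
      case True
      then have "\<forall>i\<in>I. z i = 0"
        unfolding Z_def using assms by (simp add: sum_nonneg_eq_0_iff)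
      then have "\<forall>r<Suc k. \<forall>i\<in>I. orth_proj I q v (f r) i = f r i"
        using q(3) by (auto simp: z_def less_Suc_eq)
      then show ?thesis using q by (intro exI[of _ q] exI[of _ v]) auto
    next
      case False
      then have Z: "Z > 0" unfolding Z_def by (simp add: sum_nonneg order_less_le)
      define v' where "v' = v(q := \<lambda>i. z i / sqrt Z)"
      have zv: "(\<Sum>i\<in>I. z i * v l i) = 0" if "l < q" for l
        using orth_proj_inner[OF q(2) that, of "f k"]
        by (simp add: z_def left_diff_distrib sum_subtractf)
      have 1: "(\<Sum>i\<in>I. v' q i * v' q i) = 1"
        using Z by (simp add: v'_def Z_def power2_eq_square flip: sum_divide_distrib)
      have 2: "(\<Sum>i\<in>I. v' q i * v' l i) = 0" "(\<Sum>i\<in>I. v' l i * v' q i) = 0" if "l < q" for l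
        using zv[OF that] that by (simp_all add: v'_def mult.commute flip: sum_divide_distrib)
      have on: "orthonormal_fam I (Suc q) v'"
        unfolding orthonormal_fam_def
      proof (intro allI impI)
        fix l l' assume "l < Suc q" "l' < Suc q"
        then consider "l < q" "l' < q" | "l = q" "l' < q" | "l < q" "l' = q" | "l = q" "l' = q"
          by linarith
        then show "(\<Sum>i\<in>I. v' l i * v' l' i) = (if l = l' then 1 else 0)"
          using q(2) 1 2 by cases (auto simp: orthonormal_fam_def v'_def)
      qed
      have proj: "orth_proj I (Suc q) v' x i = orth_proj I q v x i + (\<Sum>i\<in>I. x i * z i) / Z * z i" for x i
        using Z by (simp add: orth_proj_def v'_def flip: sum_divide_distrib)
      have pz: "(\<Sum>i\<in>I. orth_proj I q v x i * z i) = 0" for x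
        using orth_proj_residual_inner[OF q(2), of "f k" "\<lambda>l. \<Sum>i\<in>I. x i * v l i"]
        by (simp add: orth_proj_def z_def mult.commute)
      have "orth_proj I (Suc q) v' (f r) i = f r i" if "r < Suc k" "i \<in> I" for r i
      proof (cases "r = k")
        case True
        have "(\<Sum>i\<in>I. f k i * z i) = (\<Sum>i\<in>I. orth_proj I q v (f k) i * z i + z i * z i)"
          by (simp add: z_def algebra_simps)
        also have "\<dots> = Z" using pz by (simp add: sum.distrib Z_def power2_eq_square)
        finally have "(\<Sum>i\<in>I. f k i * z i) = Z" .
        then show ?thesis unfolding proj True using Z by (simp add: z_def)
      next
        case False
        then have r: "r < k" using that by simp
        have "(\<Sum>i\<in>I. f r i * z i) = 0"
          using q(3) r pz[of "f r"] by simp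
        then show ?thesis unfolding proj using q(3) r that by simp
      qed
      then show ?thesis using on q(1) by (intro exI[of _ "Suc q"] exI[of _ v']) auto
    qed
  qed
  then show ?thesis using that by blast
qed

text \<open>Gaussian elimination, one equation at a time: a pivot \<open>a i j0\<close> removes the
  unknown \<open>j0\<close> from the remaining equations, and back substitution restores its
  value.\<close>

lemma homogeneous_system_nontrivial:
  fixes a :: "'i \<Rightarrow> 'j \<Rightarrow> real"
  assumes "finite I" "finite J" "card I < card J"
  shows "\<exists>x. (\<exists>j\<in>J. x j \<noteq> 0) \<and> (\<forall>i\<in>I. (\<Sum>j\<in>J. a i j * x j) = 0)"
  using assms
proof (induction I arbitrary: a J rule: finite_induct)
  case empty
  then have "J \<noteq> {}" by auto
  then show ?case by (intro exI[of _ "\<lambda>_. 1"]) auto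
next
  case (insert i I)
  show ?case
  proof (cases "\<forall>j\<in>J. a i j = 0")
    case True
    have "card I < card J" using insert by simp
    from insert.IH[OF insert.prems(1) this, of a] obtain x where
      "\<exists>j\<in>J. x j \<noteq> 0" "\<forall>i\<in>I. (\<Sum>j\<in>J. a i j * x j) = 0" by blast
    then show ?thesis using True by auto
  next
    case False
    then obtain j0 where j0: "j0 \<in> J" "a i j0 \<noteq> 0" by blast
    define J' where "J' = J - {j0}"
    have J': "finite J'" "J = Collect (\<lambda>j. j = j0 \<or> j \<in> J')" "j0 \<notin> J'" "card I < card J'"
      using insert j0 by (auto simp: J'_def)
    have J: "J = insert j0 J'" using J'(2) by auto
    define a' where "a' i' j = a i' j - a i' j0 * a i j / a i j0" for i' j
    from insert.IH[OF J'(1,4), of a'] obtain x where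
      x: "\<exists>j\<in>J'. x j \<noteq> 0" "\<forall>i'\<in>I. (\<Sum>j\<in>J'. a' i' j * x j) = 0" by auto
    define S where "S = (\<Sum>j\<in>J'. a i j * x j)"
    define y where "y = x(j0 := - S / a i j0)"
    have yJ: "(\<Sum>j\<in>J'. a i' j * y j) = (\<Sum>j\<in>J'. a i' j * x j)" for i'
      using J'(3) by (intro sum.cong) (auto simp: y_def)
    have split: "(\<Sum>j\<in>J. a i' j * y j) = - a i' j0 * S / a i j0 + (\<Sum>j\<in>J'. a i' j * x j)" for i'
      unfolding J using J'(1,3) yJ by (simp add: y_def)
    have "(\<Sum>j\<in>J. a i' j * y j) = 0" if "i' \<in> insert i I" for i'
    proof (cases "i' = i")
      case True
      show ?thesis unfolding split using j0 True by (simp add: S_def)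
    next
      case False
      have "(\<Sum>j\<in>J'. a' i' j * x j) = (\<Sum>j\<in>J'. a i' j * x j) - a i' j0 / a i j0 * S"
        unfolding a'_def S_def sum_distrib_left by (simp add: algebra_simps sum_subtractf)
      then show ?thesis unfolding split using x False that by auto
    qed
    moreover have "\<exists>j\<in>J. y j \<noteq> 0" using x(1) J'(3) by (auto simp: J y_def)
    ultimately show ?thesis by blast
  qed
qed

section \<open>The truncated SVD is close to the matrix of means\<close>

lemma square_diff_le: "(a - b)\<^sup>2 \<le> 2 * a\<^sup>2 + 2 * (b::real)\<^sup>2"
  using zero_le_power2[of "a + b"] by (simp add: power2_sum power2_diff)

text \<open>Hypothesis \<open>noise\<close> bounds the squared operator norm of the noise by
  \<open>e2\<close>, in a form that applies directly to test vectors. Of the factor 5, one comes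
  from the projected noise and four from the part of the means that the projection loses.\<close>

lemma truncated_svd_dist_bound:
  fixes X M y :: "nat \<Rightarrow> nat \<Rightarrow> real"
  assumes R: "finite R" and svd: "is_truncated_svd k R n X M"
    and c: "\<And>i. i \<in> R \<Longrightarrow> c i < k"
    and noise: "\<And>x. (\<Sum>i\<in>R. (\<Sum>j<n. (X i j - y (c i) j) * x j)\<^sup>2) \<le> e2 * (\<Sum>j<n. (x j)\<^sup>2)"
    and e2: "e2 \<ge> 0"
  shows "(\<Sum>i\<in>R. \<Sum>j<n. (M i j - y (c i) j)\<^sup>2) \<le> 5 * real k * e2"
proof -
  from svd obtain p s u v where "is_svd R n X p s u v"
    and M: "\<And>i j. i \<in> R \<Longrightarrow> j < n \<Longrightarrow> M i j = (\<Sum>l<min k p. s l * u l i * v l j)"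
    unfolding is_truncated_svd_def by blast
  then have u: "orthonormal_fam R p u" and v: "orthonormal_fam {..<n} p v"
    and s0: "\<And>l. l < p \<Longrightarrow> 0 \<le> s l" and smono: "\<And>l l'. l \<le> l' \<Longrightarrow> l' < p \<Longrightarrow> s l' \<le> s l"
    and X: "\<And>i j. i \<in> R \<Longrightarrow> j < n \<Longrightarrow> X i j = (\<Sum>l<p. s l * u l i * v l j)"
    unfolding is_svd_def by auto
  define q where "q = min k p"
  define ip where "ip x z = (\<Sum>j<n. x j * z j)" for x z :: "nat \<Rightarrow> real"
  define P where "P = orth_proj {..<n} q v"
  have vq: "orthonormal_fam {..<n} q v" by (rule orthonormal_fam_mono[OF v]) (simp add: q_def)
  have ip_X: "ip (X i) x = (\<Sum>l<p. (s l * ip (v l) x) * u l i)" if "i \<in> R" for i x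
  proof -
    have "ip (X i) x = (\<Sum>j<n. \<Sum>l<p. s l * u l i * v l j * x j)"
      unfolding ip_def by (intro sum.cong refl) (simp add: X that sum_distrib_right)
    also have "\<dots> = (\<Sum>l<p. (s l * ip (v l) x) * u l i)"
      unfolding ip_def by (subst sum.swap) (simp add: sum_distrib_left sum_distrib_right mult_ac)
    finally show ?thesis .
  qed
  have ip_X_v: "ip (X i) (v l) = s l * u l i" if "i \<in> R" "l < p" for i l
  proof -
    have "ip (X i) (v l) = (\<Sum>l'<p. if l' = l then s l' * u l' i else 0)"
      using v that unfolding ip_X[OF that(1)]
      by (intro sum.cong) (auto simp: ip_def orthonormal_fam_def)
    then show ?thesis using that by (simp add: sum.delta)
  qed
  \<comment> \<open>Truncating the SVD projects each row of \<open>X\<close> onto the first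
    \<open>q\<close> right singular vectors, since
    \<open>ip (X i) (v l) = s l * u l i\<close>.\<close>
  have MP: "M i j = P (X i) j" if "i \<in> R" "j < n" for i j
    unfolding M[OF that] P_def orth_proj_def q_def[symmetric] ip_def[symmetric]
    using that by (intro sum.cong refl) (simp add: ip_X_v q_def)
  \<comment> \<open>Weyl: a nonzero vector spanned by the first \<open>k + 1\<close> right singular vectors and orthogonal to the
    \<open>k\<close> means sees only the noise.\<close>
  have weyl: "(s k)\<^sup>2 \<le> e2" if "k < p"
  proof -
    obtain a where a: "\<exists>l\<in>{..k}. a l \<noteq> 0" "\<forall>r<k. (\<Sum>l\<le>k. ip (y r) (v l) * a l) = 0"
      using homogeneous_system_nontrivial[of "{..<k}" "{..k}" "\<lambda>r l. ip (y r) (v l)"] by auto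
    define x where "x j = (\<Sum>l\<le>k. a l * v l j)" for j
    have sub: "{..k} \<subseteq> {..<p}" using that by auto
    have nx: "(\<Sum>j<n. (x j)\<^sup>2) = (\<Sum>l\<le>k. (a l)\<^sup>2)"
      unfolding x_def by (rule sum_orthonormal_sq[OF v sub])
    have pos: "(\<Sum>l\<le>k. (a l)\<^sup>2) > 0"
      using a(1) by (auto intro: sum_pos2)
    have yx: "ip (y r) x = 0" if "r < k" for r
    proof -
      have "ip (y r) x = (\<Sum>l\<le>k. ip (y r) (v l) * a l)"
        unfolding ip_def x_def sum_distrib_left sum_distrib_right
        by (subst sum.swap) (simp add: mult_ac)
      then show ?thesis using a(2) that by simp
    qed
    have vx: "ip (v l) x = (if l \<le> k then a l else 0)" if "l < p" for l
      using sum_orthonormal_mult[OF v sub that, of a]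
      by (simp add: ip_def x_def mult.commute)
    have "(s k)\<^sup>2 * (\<Sum>l\<le>k. (a l)\<^sup>2) \<le> (\<Sum>l\<le>k. (s l * a l)\<^sup>2)"
      unfolding sum_distrib_left power_mult_distrib
      using that by (intro sum_mono mult_right_mono power_mono smono s0) auto
    also have "\<dots> = (\<Sum>l\<le>k. (s l * ip (v l) x)\<^sup>2)"
      using that by (intro sum.cong refl) (auto simp: vx)
    also have "\<dots> \<le> (\<Sum>l<p. (s l * ip (v l) x)\<^sup>2)"
      by (rule sum_mono2) (use sub in auto)
    also have "\<dots> = (\<Sum>i\<in>R. (ip (X i) x)\<^sup>2)"
      by (simp add: ip_X sum_orthonormal_sq[OF u])
    also have "\<dots> = (\<Sum>i\<in>R. (\<Sum>j<n. (X i j - y (c i) j) * x j)\<^sup>2)"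
      using yx c by (intro sum.cong refl) (simp add: left_diff_distrib sum_subtractf ip_def)
    also have "\<dots> \<le> e2 * (\<Sum>l\<le>k. (a l)\<^sup>2)" using noise[of x] unfolding nx .
    finally show ?thesis using pos by simp
  qed
  \<comment> \<open>The discarded part consists of the singular values with index at least
    \<open>q\<close>. There are any only if \<open>k < p\<close>; then \<open>q = k\<close>, and all
    of them are at most \<open>s k\<close>, which \<open>weyl\<close> controls.\<close>
  have tail: "(\<Sum>i\<in>R. (\<Sum>j<n. (X i j - M i j) * x j)\<^sup>2) \<le> e2 * (\<Sum>j<n. (x j)\<^sup>2)" for x
  proof -
    have "(\<Sum>j<n. (X i j - M i j) * x j) = (\<Sum>l\<in>{q..<p}. (s l * ip (v l) x) * u l i)" if "i \<in> R" for i
    proof -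
      have "ip (M i) x = (\<Sum>l<q. (s l * ip (v l) x) * u l i)"
      proof -
        have "ip (M i) x = (\<Sum>j<n. \<Sum>l<q. s l * u l i * v l j * x j)"
          unfolding ip_def q_def by (intro sum.cong refl) (simp add: M that sum_distrib_right)
        also have "\<dots> = (\<Sum>l<q. (s l * ip (v l) x) * u l i)"
          unfolding ip_def by (subst sum.swap) (simp add: sum_distrib_left sum_distrib_right mult_ac)
        finally show ?thesis .
      qed
      moreover have "(\<Sum>l<p. (s l * ip (v l) x) * u l i) =
          (\<Sum>l<q. (s l * ip (v l) x) * u l i) + (\<Sum>l\<in>{q..<p}. (s l * ip (v l) x) * u l i)"
        unfolding q_def by (simp add: lessThan_atLeast0 sum.atLeastLessThan_concat)
      ultimately show ?thesis using ip_X[OF that, of x]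
        by (simp add: ip_def left_diff_distrib sum_subtractf)
    qed
    then have "(\<Sum>i\<in>R. (\<Sum>j<n. (X i j - M i j) * x j)\<^sup>2)
        = (\<Sum>i\<in>R. (\<Sum>l\<in>{q..<p}. (s l * ip (v l) x) * u l i)\<^sup>2)" by simp
    also have "\<dots> = (\<Sum>l\<in>{q..<p}. (s l * ip (v l) x)\<^sup>2)"
      by (rule sum_orthonormal_sq[OF u]) auto
    also have "\<dots> \<le> (\<Sum>l\<in>{q..<p}. e2 * (ip (v l) x)\<^sup>2)"
    proof (rule sum_mono)
      fix l assume l: "l \<in> {q..<p}"
      then have "k < p" "k \<le> l" by (auto simp: q_def min_def split: if_splits)
      then have "(s l)\<^sup>2 \<le> (s k)\<^sup>2" using l by (intro power_mono smono s0) auto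
      also have "\<dots> \<le> e2" by (rule weyl) fact
      finally show "(s l * ip (v l) x)\<^sup>2 \<le> e2 * (ip (v l) x)\<^sup>2"
        unfolding power_mult_distrib by (rule mult_right_mono) simp
    qed
    also have "\<dots> \<le> (\<Sum>l<p. e2 * (ip (v l) x)\<^sup>2)"
      by (rule sum_mono2) (use e2 in auto)
    also have "\<dots> \<le> e2 * (\<Sum>j<n. (x j)\<^sup>2)"
      using mult_left_mono[OF bessel_inequality[OF v, of x] e2]
      by (simp add: ip_def mult.commute sum_distrib_left)
    finally show ?thesis .
  qed
  define z where "z r j = y r j - P (y r) j" for r j
  obtain q' w where q': "q' \<le> k" and w: "orthonormal_fam {..<n} q' w"
    and wz: "\<And>r j. r < k \<Longrightarrow> j \<in> {..<n} \<Longrightarrow> orth_proj {..<n} q' w (z r) j = z r j"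
    using gram_schmidt[of "{..<n}" k z] by auto
  \<comment> \<open>The residuals \<open>z r\<close> span at most \<open>k\<close> dimensions, so their Frobenius norm is controlled by the
    action on an orthonormal basis \<open>w\<close>, that is, by \<open>tail\<close> and the noise.\<close>
  have residual: "(\<Sum>i\<in>R. \<Sum>j<n. (z (c i) j)\<^sup>2) \<le> 4 * real k * e2"
  proof -
    have "(\<Sum>i\<in>R. (ip (z (c i)) (w l))\<^sup>2) \<le> 4 * e2" if l: "l < q'" for l
    proof -
      define w' where "w' j = w l j - P (w l) j" for j
      have "(\<Sum>j<n. (w' j)\<^sup>2) \<le> (\<Sum>j<n. (w l j)\<^sup>2)"
        unfolding w'_def P_def by (rule orth_proj_residual_sq_le[OF vq])
      also have "\<dots> = 1" using w l by (simp add: orthonormal_fam_def power2_eq_square)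
      finally have nw: "(\<Sum>j<n. (w' j)\<^sup>2) \<le> 1" .
      \<comment> \<open>The residual map is self-adjoint, so it moves from the rows to the basis
        vector \<open>w l\<close>. A residual of a mean then becomes the discarded part of the data
        tested on \<open>w l\<close> minus the noise tested on \<open>w'\<close>.\<close>
      have adj: "ip (\<lambda>j. f j - P f j) (w l) = ip f w'" for f
        using orth_proj_self_adjoint[of "{..<n}" q v f "w l"]
        by (simp add: ip_def w'_def P_def algebra_simps sum_subtractf)
      have eq: "ip (z (c i)) (w l)
          = (\<Sum>j<n. (X i j - M i j) * w l j) - (\<Sum>j<n. (X i j - y (c i) j) * w' j)"
        if "i \<in> R" for i
      proof -
        have "(\<Sum>j<n. (X i j - M i j) * w l j) = ip (X i) w'"
          using that by (subst adj[symmetric], unfold ip_def, intro sum.cong refl) (simp add: MP)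
        moreover have "ip (z (c i)) (w l) = ip (y (c i)) w'"
          unfolding adj[symmetric] z_def ..
        ultimately show ?thesis by (simp add: ip_def left_diff_distrib sum_subtractf)
      qed
      have "(\<Sum>i\<in>R. (ip (z (c i)) (w l))\<^sup>2)
         \<le> (\<Sum>i\<in>R. 2 * (\<Sum>j<n. (X i j - M i j) * w l j)\<^sup>2 + 2 * (\<Sum>j<n. (X i j - y (c i) j) * w' j)\<^sup>2)"
      proof (rule sum_mono)
        fix i assume "i \<in> R"
        show "(ip (z (c i)) (w l))\<^sup>2 \<le> 2 * (\<Sum>j<n. (X i j - M i j) * w l j)\<^sup>2 + 2 * (\<Sum>j<n. (X i j - y (c i) j) * w' j)\<^sup>2"
          unfolding eq[OF \<open>i \<in> R\<close>] by (rule square_diff_le)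
      qed
      also have "\<dots> \<le> 2 * (e2 * (\<Sum>j<n. (w l j)\<^sup>2)) + 2 * (e2 * (\<Sum>j<n. (w' j)\<^sup>2))"
        unfolding sum.distrib sum_distrib_left[symmetric]
        by (intro add_mono mult_left_mono tail noise) auto
      also have "\<dots> \<le> 4 * e2"
        using \<open>(\<Sum>j<n. (w l j)\<^sup>2) = 1\<close> mult_left_mono[OF nw e2] by simp
      finally show ?thesis .
    qed
    then have "(\<Sum>l<q'. \<Sum>i\<in>R. (ip (z (c i)) (w l))\<^sup>2) \<le> (\<Sum>l<q'. 4 * e2)"
      by (intro sum_mono) auto
    also have "\<dots> \<le> 4 * real k * e2" using q' e2 by (simp add: mult_right_mono)
    finally have "(\<Sum>i\<in>R. \<Sum>l<q'. (ip (z (c i)) (w l))\<^sup>2) \<le> 4 * real k * e2"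
      by (subst sum.swap)
    moreover have "(\<Sum>j<n. (z (c i) j)\<^sup>2) = (\<Sum>l<q'. (ip (z (c i)) (w l))\<^sup>2)" if "i \<in> R" for i
      unfolding ip_def by (rule parseval_of_orth_proj_eq[OF w]) (use wz c that in auto)
    ultimately show ?thesis by simp
  qed
  \<comment> \<open>Row by row, \<open>M i - y (c i)\<close> is the projected noise minus the
    residual of the mean, and the two are orthogonal.\<close>
  have row: "(\<Sum>j<n. (M i j - y (c i) j)\<^sup>2)
      = (\<Sum>l<q. (\<Sum>j<n. (X i j - y (c i) j) * v l j)\<^sup>2) + (\<Sum>j<n. (z (c i) j)\<^sup>2)" if "i \<in> R" for i
  proof -
    have "(\<Sum>j<n. (M i j - y (c i) j)\<^sup>2) = (\<Sum>j<n. ((\<Sum>l<q. ip (\<lambda>j. X i j - y (c i) j) (v l) * v l j)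
        - (y (c i) j - P (y (c i)) j))\<^sup>2)"
    proof (intro sum.cong refl)
      fix j assume "j \<in> {..<n}"
      then have "M i j = P (X i) j" using MP that by simp
      moreover have "(\<Sum>l<q. ip (\<lambda>j. X i j - y (c i) j) (v l) * v l j) = P (X i) j - P (y (c i)) j"
        by (simp add: P_def orth_proj_def ip_def left_diff_distrib sum_subtractf)
      ultimately show "(M i j - y (c i) j)\<^sup>2 = ((\<Sum>l<q. ip (\<lambda>j. X i j - y (c i) j) (v l) * v l j)
        - (y (c i) j - P (y (c i)) j))\<^sup>2" by simp
    qed
    then show ?thesis
      using orthonormal_pythagoras[OF vq, of "\<lambda>l. ip (\<lambda>j. X i j - y (c i) j) (v l)" "y (c i)"]
      by (simp add: P_def[symmetric] z_def ip_def)
  qed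
  have "(\<Sum>i\<in>R. \<Sum>l<q. (\<Sum>j<n. (X i j - y (c i) j) * v l j)\<^sup>2) \<le> real k * e2"
  proof -
    have "(\<Sum>l<q. \<Sum>i\<in>R. (\<Sum>j<n. (X i j - y (c i) j) * v l j)\<^sup>2) \<le> (\<Sum>l<q. e2)"
    proof (rule sum_mono)
      fix l assume "l \<in> {..<q}"
      then have "(\<Sum>j<n. (v l j)\<^sup>2) = 1" using vq by (simp add: orthonormal_fam_def power2_eq_square)
      then show "(\<Sum>i\<in>R. (\<Sum>j<n. (X i j - y (c i) j) * v l j)\<^sup>2) \<le> e2" using noise[of "v l"] by simp
    qed
    also have "\<dots> \<le> real k * e2" using e2 by (simp add: mult_right_mono q_def)
    finally show ?thesis by (subst sum.swap)
  qed
  then show ?thesis using residual by (simp add: row sum.distrib)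
qed

section \<open>Accuracy of the centers\<close>

lemma vec_dist_sq: "(vec_dist n x y)\<^sup>2 = (\<Sum>j<n. (x j - y j)\<^sup>2)"
  by (simp add: vec_dist_def L2_set_def sum_nonneg)

lemma vec_dist_nonneg: "0 \<le> vec_dist n x y"
  by (simp add: vec_dist_def)

lemma vec_dist_commute: "vec_dist n x y = vec_dist n y x"
  by (simp add: vec_dist_def L2_set_def power2_commute)

lemma vec_dist_triangle: "vec_dist n x z \<le> vec_dist n x y + vec_dist n y z"
  unfolding vec_dist_def
  using L2_set_triangle_ineq[of "\<lambda>j. x j - y j" "\<lambda>j. y j - z j" "{..<n}"] by simp

lemma vec_dist_cong:
  "(\<And>j. j < n \<Longrightarrow> x j = x' j) \<Longrightarrow> (\<And>j. j < n \<Longrightarrow> y j = y' j) \<Longrightarrow> vec_dist n x y = vec_dist n x' y'"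
  unfolding vec_dist_def by (intro L2_set_cong) auto

text \<open>In each coordinate the deviations from the mean sum to zero, so moving the center from
  the mean \<open>a\<close> to \<open>z j\<close> only adds \<open>card U\<close> times the squared
  shift.\<close>

lemma row_mean_sum_sq_le:
  assumes "finite U"
  shows "(\<Sum>i\<in>U. (vec_dist n (X i) (row_mean U X))\<^sup>2) \<le> (\<Sum>i\<in>U. (vec_dist n (X i) z)\<^sup>2)"
proof -
  have "(\<Sum>i\<in>U. (X i j - row_mean U X j)\<^sup>2) \<le> (\<Sum>i\<in>U. (X i j - z j)\<^sup>2)" for j
  proof -
    define a where "a = row_mean U X j"
    have "(\<Sum>i\<in>U. X i j) = real (card U) * a"
      using assms by (cases "U = {}") (auto simp: a_def row_mean_def)
    then have "(\<Sum>i\<in>U. X i j - a) = 0" by (simp add: sum_subtractf)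
    moreover have "(\<Sum>i\<in>U. (X i j - z j)\<^sup>2)
        = (\<Sum>i\<in>U. (X i j - a)\<^sup>2 + (a - z j)\<^sup>2 + 2 * (a - z j) * (X i j - a))"
      by (intro sum.cong refl) (simp add: power2_eq_square algebra_simps)
    ultimately have "(\<Sum>i\<in>U. (X i j - z j)\<^sup>2) = (\<Sum>i\<in>U. (X i j - a)\<^sup>2) + real (card U) * (a - z j)\<^sup>2"
      by (simp add: sum.distrib sum_distrib_left[symmetric])
    then show ?thesis by (simp add: a_def)
  qed
  then have "(\<Sum>j<n. \<Sum>i\<in>U. (X i j - row_mean U X j)\<^sup>2) \<le> (\<Sum>j<n. \<Sum>i\<in>U. (X i j - z j)\<^sup>2)"
    by (rule sum_mono)
  then show ?thesis unfolding vec_dist_sq by (subst (1 2) sum.swap)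
qed

section \<open>The cost of a k-means partition\<close>

lemma sum_label_class:
  fixes f :: "nat \<Rightarrow> real"
  assumes "finite R" "\<And>i. i \<in> R \<Longrightarrow> lab i < k"
  shows "(\<Sum>r<k. \<Sum>i\<in>label_class R lab r. f i) = (\<Sum>i\<in>R. f i)"
proof -
  have "(\<Sum>r<k. \<Sum>i\<in>{i\<in>R. lab i = r}. f i) = (\<Sum>i\<in>R. f i)"
    by (rule sum.group) (use assms in auto)
  then show ?thesis by (simp add: label_class_def)
qed

lemma finite_label_class: "finite R \<Longrightarrow> finite (label_class R lab r)"
  by (simp add: label_class_def)

lemma kmeans_cost_eq:
  assumes "finite R" "\<And>i. i \<in> R \<Longrightarrow> lab i < k"
  shows "kmeans_cost k R n M lab
       = (\<Sum>i\<in>R. (vec_dist n (M i) (row_mean (label_class R lab (lab i)) M))\<^sup>2)"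
proof -
  have "kmeans_cost k R n M lab
      = (\<Sum>r<k. \<Sum>i\<in>label_class R lab r. (vec_dist n (M i) (row_mean (label_class R lab (lab i)) M))\<^sup>2)"
    unfolding kmeans_cost_def by (intro sum.cong refl) (auto simp: label_class_def)
  then show ?thesis using sum_label_class[OF assms] by simp
qed

text \<open>The true labeling competes in the minimization, and its cost only grows when the means
  of its classes are replaced by the points \<open>y r\<close>.\<close>

lemma is_kmeans_cost_le:
  assumes "finite R" "is_kmeans k R n M lab" "\<And>i. i \<in> R \<Longrightarrow> c i < k"
  shows "(\<Sum>i\<in>R. (vec_dist n (M i) (row_mean (label_class R lab (lab i)) M))\<^sup>2)
       \<le> (\<Sum>i\<in>R. (vec_dist n (M i) (y (c i)))\<^sup>2)"
proof -
  have lab: "\<And>i. i \<in> R \<Longrightarrow> lab i < k" and "kmeans_cost k R n M lab \<le> kmeans_cost k R n M c"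
    using assms(2,3) unfolding is_kmeans_def is_arg_min_linorder by auto
  then have "(\<Sum>i\<in>R. (vec_dist n (M i) (row_mean (label_class R lab (lab i)) M))\<^sup>2)
     \<le> kmeans_cost k R n M c" using kmeans_cost_eq[OF assms(1), of lab k] by simp
  also have "\<dots> \<le> (\<Sum>r<k. \<Sum>i\<in>label_class R c r. (vec_dist n (M i) (y r))\<^sup>2)"
    unfolding kmeans_cost_def
    by (intro sum_mono row_mean_sum_sq_le finite_label_class assms)
  also have "\<dots> = (\<Sum>r<k. \<Sum>i\<in>label_class R c r. (vec_dist n (M i) (y (c i)))\<^sup>2)"
    by (intro sum.cong refl) (auto simp: label_class_def)
  also have "\<dots> = (\<Sum>i\<in>R. (vec_dist n (M i) (y (c i)))\<^sup>2)"
    by (rule sum_label_class[OF assms(1,3)])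
  finally show ?thesis .
qed

lemma vec_dist_row_mean_le:
  assumes "finite U" "U \<noteq> {}"
  shows "(vec_dist n (row_mean U X) (row_mean U Y))\<^sup>2 \<le> (\<Sum>i\<in>U. (vec_dist n (X i) (Y i))\<^sup>2) / real (card U)"
proof -
  have "(row_mean U X j - row_mean U Y j)\<^sup>2 \<le> (\<Sum>i\<in>U. (X i j - Y i j)\<^sup>2) / real (card U)" for j
  proof -
    have c: "real (card U) > 0" using assms by (simp add: card_gt_0_iff)
    have "(\<Sum>i\<in>U. X i j - Y i j)\<^sup>2 \<le> (\<Sum>i\<in>U. (X i j - Y i j)\<^sup>2) * (\<Sum>i\<in>U. 1\<^sup>2)"
      using Cauchy_Schwarz_ineq_sum[of "\<lambda>i. X i j - Y i j" "\<lambda>_. 1" U] by simp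
    moreover have "row_mean U X j - row_mean U Y j = (\<Sum>i\<in>U. X i j - Y i j) / real (card U)"
      by (simp add: row_mean_def sum_subtractf diff_divide_distrib)
    ultimately have "(row_mean U X j - row_mean U Y j)\<^sup>2
        \<le> (\<Sum>i\<in>U. (X i j - Y i j)\<^sup>2) * real (card U) / (real (card U))\<^sup>2"
      using c by (simp add: power_divide divide_right_mono)
    then show ?thesis using c by (simp add: power2_eq_square)
  qed
  then have "(\<Sum>j<n. (row_mean U X j - row_mean U Y j)\<^sup>2) \<le> (\<Sum>j<n. (\<Sum>i\<in>U. (X i j - Y i j)\<^sup>2) / real (card U))"
    by (intro sum_mono)
  also have "\<dots> = (\<Sum>i\<in>U. \<Sum>j<n. (X i j - Y i j)\<^sup>2) / real (card U)"
    by (subst sum.swap) (simp add: sum_divide_distrib)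
  finally show ?thesis by (simp add: vec_dist_sq)
qed

text \<open>The noise is tested against the difference \<open>x\<close> of the two means itself.
  Cauchy-Schwarz over \<open>U\<close> and the operator norm bound give
  \<open>(card U * D)^2 \<le> e2 * D * card U\<close>. This handles averages of the raw data, whose
  summed squared distance to the true means need not be small.\<close>

lemma vec_dist_row_mean_noise:
  assumes U: "U \<subseteq> R" "finite R" "U \<noteq> {}"
    and noise: "\<And>x. (\<Sum>i\<in>R. (\<Sum>j<n. (X i j - Y i j) * x j)\<^sup>2) \<le> e2 * (\<Sum>j<n. (x j)\<^sup>2)"
    and e2: "e2 \<ge> 0"
  shows "(vec_dist n (row_mean U X) (row_mean U Y))\<^sup>2 \<le> e2 / real (card U)"
proof -
  have fU: "finite U" using U finite_subset by blast
  then have c: "real (card U) > 0" using U by (simp add: card_gt_0_iff)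
  define x where "x j = row_mean U X j - row_mean U Y j" for j
  define D where "D = (\<Sum>j<n. (x j)\<^sup>2)"
  have xs: "real (card U) * x j = (\<Sum>i\<in>U. X i j - Y i j)" for j
    using c by (simp add: x_def row_mean_def sum_subtractf right_diff_distrib)
  have "real (card U) * D = (\<Sum>j<n. (real (card U) * x j) * x j)"
    by (simp add: D_def sum_distrib_left power2_eq_square mult.assoc)
  also have "\<dots> = (\<Sum>i\<in>U. \<Sum>j<n. (X i j - Y i j) * x j)"
    unfolding xs sum_distrib_right by (rule sum.swap)
  finally have "(real (card U) * D)\<^sup>2 = (\<Sum>i\<in>U. \<Sum>j<n. (X i j - Y i j) * x j)\<^sup>2" by simp
  also have "\<dots> \<le> (\<Sum>i\<in>U. (\<Sum>j<n. (X i j - Y i j) * x j)\<^sup>2) * real (card U)"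
    using Cauchy_Schwarz_ineq_sum[of "\<lambda>i. \<Sum>j<n. (X i j - Y i j) * x j" "\<lambda>_. 1" U] by simp
  also have "\<dots> \<le> (\<Sum>i\<in>R. (\<Sum>j<n. (X i j - Y i j) * x j)\<^sup>2) * real (card U)"
    using U by (intro mult_right_mono sum_mono2) auto
  also have "\<dots> \<le> (e2 * D) * real (card U)"
    using noise[of x] c by (intro mult_right_mono) (auto simp: D_def)
  finally have "(real (card U) * D) * (real (card U) * D) \<le> e2 * (real (card U) * D)"
    by (simp add: power2_eq_square mult_ac)
  moreover have "0 \<le> D" by (simp add: D_def sum_nonneg)
  ultimately have "real (card U) * D \<le> e2"
    using e2 c by (cases "D = 0") auto
  then show ?thesis using c by (simp add: vec_dist_sq D_def x_def field_simps)
qed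

text \<open>\<open>W\<close> stands for the minimal weight times the number of rows; a half contains
  at least a quarter of each cluster. A row is judged by the distance \<open>d\<close> between its
  k-means center and its true mean. Every cluster has a row with small \<open>d\<close>, which
  defines the matching of labels, and few rows have large \<open>d\<close>. The bound on the entries
  of the centers feeds the later tail estimate.\<close>

lemma centers_close:
  assumes R: "finite R" and ctr: "is_centers k n R B ctr"
    and c: "\<And>i. i \<in> R \<Longrightarrow> c i < k"
    and noise: "\<And>x. (\<Sum>i\<in>R. (\<Sum>j<n. (real_matrix B i j - y (c i) j) * x j)\<^sup>2) \<le> e2 * (\<Sum>j<n. (x j)\<^sup>2)"
    and e2: "e2 \<ge> 0" "real k * e2 \<le> 0.0002 * W * \<Delta>\<^sup>2" and pos: "W > 0" "\<Delta> > 0" "k > 0"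
    and card: "\<And>r. r < k \<Longrightarrow> W / 4 \<le> real (card (label_class R c r))"
    and sep: "\<And>r s. r < k \<Longrightarrow> s < k \<Longrightarrow> r \<noteq> s \<Longrightarrow> \<Delta> \<le> vec_dist n (y r) (y s)"
  obtains \<pi> where "bij_betw \<pi> {..<k} {..<k}"
    "\<And>r. r < k \<Longrightarrow> vec_dist n (ctr (\<pi> r)) (y r) \<le> 0.24 * \<Delta>"
    "\<And>r j. r < k \<Longrightarrow> j < n \<Longrightarrow>
       0 \<le> ctr (\<pi> r) j \<and> ctr (\<pi> r) j \<le> (\<Sum>i\<in>R. real_matrix B i j) / (0.24 * W)"
proof -
  obtain M lab where svd: "is_truncated_svd k R n (real_matrix B) M" and km: "is_kmeans k R n M lab"
    and ctr: "\<And>r j. r < k \<Longrightarrow> j < n \<Longrightarrow> ctr r j = row_mean (label_class R lab r) (real_matrix B) j"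
    using ctr unfolding is_centers_def by blast
  have lab: "\<And>i. i \<in> R \<Longrightarrow> lab i < k"
    using km unfolding is_kmeans_def is_arg_min_linorder by auto
  define U where "U = label_class R lab"
  define \<nu> where "\<nu> r = row_mean (U r) M" for r
  define d where "d i = vec_dist n (\<nu> (lab i)) (y (c i))" for i
  \<comment> \<open>\<open>F\<close> bounds both the distance of \<open>M\<close> to the true means and the optimal k-means cost.\<close>
  define F where "F = 0.001 * W * \<Delta>\<^sup>2"
  have "(\<Sum>i\<in>R. (vec_dist n (M i) (y (c i)))\<^sup>2) \<le> 5 * real k * e2"
    unfolding vec_dist_sq by (rule truncated_svd_dist_bound[OF R svd c noise e2(1)])
  also have "\<dots> \<le> F" using e2(2) by (simp add: F_def)
  finally have FM: "(\<Sum>i\<in>R. (vec_dist n (M i) (y (c i)))\<^sup>2) \<le> F" .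
  have Fnu: "(\<Sum>i\<in>R. (vec_dist n (M i) (\<nu> (lab i)))\<^sup>2) \<le> F"
    using is_kmeans_cost_le[where y = y and c = c, OF R km c] FM by (simp add: \<nu>_def U_def)
  have Fd: "(\<Sum>i\<in>R. (d i)\<^sup>2) \<le> 4 * F"
  proof -
    have "(d i)\<^sup>2 \<le> 2 * (vec_dist n (M i) (\<nu> (lab i)))\<^sup>2 + 2 * (vec_dist n (M i) (y (c i)))\<^sup>2" for i
    proof -
      have "(d i)\<^sup>2 \<le> (vec_dist n (M i) (\<nu> (lab i)) + vec_dist n (M i) (y (c i)))\<^sup>2"
        unfolding d_def using vec_dist_triangle[of n "\<nu> (lab i)" "y (c i)" "M i"]
        by (intro power_mono) (auto simp: vec_dist_commute vec_dist_nonneg)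
      also have "\<dots> \<le> 2 * (vec_dist n (M i) (\<nu> (lab i)))\<^sup>2 + 2 * (vec_dist n (M i) (y (c i)))\<^sup>2"
        using square_diff_le[of "vec_dist n (M i) (\<nu> (lab i))" "- vec_dist n (M i) (y (c i))"] by simp
      finally show ?thesis .
    qed
    then have "(\<Sum>i\<in>R. (d i)\<^sup>2)
      \<le> (\<Sum>i\<in>R. 2 * (vec_dist n (M i) (\<nu> (lab i)))\<^sup>2 + 2 * (vec_dist n (M i) (y (c i)))\<^sup>2)"
      by (intro sum_mono)
    also have "\<dots> \<le> 4 * F" using FM Fnu by (simp add: sum.distrib flip: sum_distrib_left)
    finally show ?thesis .
  qed
  \<comment> \<open>Otherwise this cluster alone would contribute at least
    \<open>W / 4 * (0.13 * \<Delta>)^2 = 0.004225 * W * \<Delta>^2\<close>, more than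
    \<open>4 * F = 0.004 * W * \<Delta>^2\<close>.\<close>
  have "\<exists>i\<in>label_class R c r. d i \<le> 0.13 * \<Delta>" if r: "r < k" for r
  proof (rule ccontr)
    assume *: "\<not> ?thesis"
    let ?V = "label_class R c r"
    have fV: "finite ?V" by (rule finite_label_class[OF R])
    have "W / 4 * (0.13 * \<Delta>)\<^sup>2 \<le> real (card ?V) * (0.13 * \<Delta>)\<^sup>2"
      by (intro mult_right_mono card r) auto
    also have "\<dots> = (\<Sum>i\<in>?V. (0.13 * \<Delta>)\<^sup>2)" by simp
    also have "\<dots> \<le> (\<Sum>i\<in>?V. (d i)\<^sup>2)"
      using * pos by (intro sum_mono power_mono) auto
    also have "\<dots> \<le> (\<Sum>i\<in>R. (d i)\<^sup>2)"
      using R by (intro sum_mono2) (auto simp: label_class_def)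
    also have "\<dots> \<le> 4 * F" by (rule Fd)
    finally have "(0.004225 - 0.004) * (W * \<Delta>\<^sup>2) \<le> 0"
      by (simp add: F_def power_mult_distrib power_divide)
    moreover have "W * \<Delta>\<^sup>2 > 0" using pos by simp
    ultimately show False by simp
  qed
  then obtain i0 where i0: "\<And>r. r < k \<Longrightarrow> i0 r \<in> label_class R c r" "\<And>r. r < k \<Longrightarrow> d (i0 r) \<le> 0.13 * \<Delta>"
    by metis
  \<comment> \<open>The estimated label of a representative row. Equal labels for two clusters would
    put both means within \<open>0.13 * \<Delta>\<close> of one k-means center, against the
    separation.\<close>
  define \<pi> where "\<pi> r = lab (i0 r)" for r
  have i0R: "i0 r \<in> R" "c (i0 r) = r" if "r < k" for r
    using i0(1)[OF that] by (auto simp: label_class_def)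
  have \<pi>k: "\<pi> r < k" if "r < k" for r using lab i0R that by (simp add: \<pi>_def)
  have \<nu>\<pi>: "vec_dist n (\<nu> (\<pi> r)) (y r) \<le> 0.13 * \<Delta>" if "r < k" for r
    using i0(2)[OF that] i0R[OF that] by (simp add: d_def \<pi>_def)
  have "inj_on \<pi> {..<k}"
  proof (rule inj_onI, rule ccontr)
    fix r s assume rs: "r \<in> {..<k}" "s \<in> {..<k}" "\<pi> r = \<pi> s" "r \<noteq> s"
    then have "\<Delta> \<le> vec_dist n (y r) (y s)" by (intro sep) auto
    also have "\<dots> \<le> vec_dist n (\<nu> (\<pi> r)) (y r) + vec_dist n (\<nu> (\<pi> s)) (y s)"
      using vec_dist_triangle[of n "y r" "y s" "\<nu> (\<pi> r)"] rs(3)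
      by (simp add: vec_dist_commute)
    also have "\<dots> \<le> 0.13 * \<Delta> + 0.13 * \<Delta>" using rs by (intro add_mono \<nu>\<pi>) auto
    finally show False using pos by simp
  qed
  then have bij: "bij_betw \<pi> {..<k} {..<k}"
    unfolding bij_betw_def using \<pi>k by (intro conjI endo_inj_surj) auto
  \<comment> \<open>A wrong label would place two distinct means within
    \<open>0.13 * \<Delta> + 0.8 * \<Delta> < \<Delta>\<close> of each other.\<close>
  have good: "lab i = \<pi> (c i)" if i: "i \<in> R" "d i < 0.8 * \<Delta>" for i
  proof -
    obtain s where s: "s < k" "lab i = \<pi> s"
      using bij lab[OF i(1)] by (auto simp: bij_betw_def)
    have "s = c i"
    proof (rule ccontr)
      assume "s \<noteq> c i"
      then have "\<Delta> \<le> vec_dist n (y s) (y (c i))" using s c i by (intro sep) auto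
      also have "\<dots> \<le> vec_dist n (\<nu> (\<pi> s)) (y s) + d i"
        using vec_dist_triangle[of n "y s" "y (c i)" "\<nu> (\<pi> s)"] s(2)
        by (simp add: d_def vec_dist_commute)
      also have "\<dots> < 0.13 * \<Delta> + 0.8 * \<Delta>" using i(2) \<nu>\<pi>[OF s(1)] by linarith
      finally show False using pos by simp
    qed
    then show ?thesis using s by simp
  qed
  \<comment> \<open>At most \<open>4 * F / (0.8 * \<Delta>)^2 = 0.01 * W\<close> rows are bad, and
    \<open>W / 4 - 0.01 * W = 0.24 * W\<close>.\<close>
  have cardU: "0.24 * W \<le> real (card (U (\<pi> r)))" if r: "r < k" for r
  proof -
    let ?V = "label_class R c r"
    define bad where "bad = {i\<in>?V. 0.8 * \<Delta> \<le> d i}"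
    have fin: "finite ?V" "finite bad" using R by (auto simp: bad_def label_class_def)
    have "real (card bad) * (0.8 * \<Delta>)\<^sup>2 = (\<Sum>i\<in>bad. (0.8 * \<Delta>)\<^sup>2)" by simp
    also have "\<dots> \<le> (\<Sum>i\<in>bad. (d i)\<^sup>2)"
      using pos by (intro sum_mono power_mono) (auto simp: bad_def)
    also have "\<dots> \<le> (\<Sum>i\<in>R. (d i)\<^sup>2)"
      using R by (intro sum_mono2) (auto simp: label_class_def bad_def)
    also have "\<dots> \<le> 4 * F" by (rule Fd)
    finally have "(real (card bad) * 0.64) * \<Delta>\<^sup>2 \<le> (0.0064 * W) * \<Delta>\<^sup>2"
      using pos by (simp add: F_def power_mult_distrib power_divide)
    then have "real (card bad) * 0.64 \<le> 0.0064 * W" using pos by simp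
    then have "0.24 * W \<le> real (card ?V) - real (card bad)" using card[OF r] by simp
    also have "\<dots> = real (card (?V - bad))"
      using fin by (subst card_Diff_subset) (auto simp: bad_def card_mono of_nat_diff)
    also have "\<dots> \<le> real (card (U (\<pi> r)))"
      using R good by (intro of_nat_mono card_mono) (force simp: bad_def U_def label_class_def)+
    finally show ?thesis .
  qed
  \<comment> \<open>Three errors add up over the estimated class: averaged noise
    (\<open>0.03\<close>), average of \<open>M\<close> against the average of the true means
    (\<open>0.07\<close>), and the k-means center against \<open>y r\<close> (\<open>0.13\<close>).
    The intermediate average \<open>row_mean ?U Y\<close> includes the means of misclassified
    rows.\<close>
  have "vec_dist n (ctr (\<pi> r)) (y r) \<le> 0.24 * \<Delta>" if r: "r < k" for r
  proof -
    let ?U = "U (\<pi> r)"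
    define Y where "Y i = y (c i)" for i
    have cU: "0.24 * W \<le> real (card ?U)" "real (card ?U) > 0" using cardU[OF r] pos by auto
    have U: "?U \<subseteq> R" "finite ?U" using R by (auto simp: U_def label_class_def)
    have "?U \<noteq> {}" using cU(2) by (intro notI) simp
    have bound: "a / real (card ?U) \<le> b" if "a \<le> b * (0.24 * W)" "b \<ge> 0" for a b :: real
    proof -
      have "a \<le> b * real (card ?U)" using that mult_left_mono[OF cU(1) that(2)] by linarith
      then show ?thesis using cU(2) by (simp add: field_simps)
    qed
    have "(vec_dist n (row_mean ?U (real_matrix B)) (row_mean ?U Y))\<^sup>2 \<le> e2 / real (card ?U)"
      using noise by (intro vec_dist_row_mean_noise[OF U(1) R \<open>?U \<noteq> {}\<close> _ e2(1)]) (simp add: Y_def)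
    also have "\<dots> \<le> (0.03 * \<Delta>)\<^sup>2"
    proof (rule bound)
      have "e2 \<le> real k * e2" using pos e2(1) by (simp add: mult_le_cancel_right1)
      also have "\<dots> \<le> 0.0002 * (W * \<Delta>\<^sup>2)" using e2(2) by (simp add: mult.assoc)
      also have "\<dots> \<le> 0.000216 * (W * \<Delta>\<^sup>2)" using pos by (intro mult_right_mono) auto
      finally show "e2 \<le> (0.03 * \<Delta>)\<^sup>2 * (0.24 * W)" by (simp add: power_mult_distrib power_divide mult_ac)
    qed simp
    finally have 1: "vec_dist n (row_mean ?U (real_matrix B)) (row_mean ?U Y) \<le> 0.03 * \<Delta>"
      by (rule power2_le_imp_le) (use pos in simp)
    have "(vec_dist n (row_mean ?U M) (row_mean ?U Y))\<^sup>2 \<le> (\<Sum>i\<in>?U. (vec_dist n (M i) (Y i))\<^sup>2) / real (card ?U)"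
      by (rule vec_dist_row_mean_le) fact+
    also have "\<dots> \<le> (0.07 * \<Delta>)\<^sup>2"
    proof (rule bound)
      have "(\<Sum>i\<in>?U. (vec_dist n (M i) (Y i))\<^sup>2) \<le> (\<Sum>i\<in>R. (vec_dist n (M i) (Y i))\<^sup>2)"
        using U R by (intro sum_mono2) auto
      also have "\<dots> \<le> 0.001 * (W * \<Delta>\<^sup>2)" using FM by (simp add: F_def Y_def)
      also have "\<dots> \<le> 0.001176 * (W * \<Delta>\<^sup>2)" using pos by (intro mult_right_mono) auto
      finally show "(\<Sum>i\<in>?U. (vec_dist n (M i) (Y i))\<^sup>2) \<le> (0.07 * \<Delta>)\<^sup>2 * (0.24 * W)"
        by (simp add: power_mult_distrib power_divide mult_ac)
    qed simp
    finally have 2: "vec_dist n (row_mean ?U M) (row_mean ?U Y) \<le> 0.07 * \<Delta>"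
      by (rule power2_le_imp_le) (use pos in simp)
    have "vec_dist n (ctr (\<pi> r)) (y r) = vec_dist n (row_mean ?U (real_matrix B)) (y r)"
      using ctr \<pi>k[OF r] by (intro vec_dist_cong) (auto simp: U_def)
    also have "\<dots> \<le> vec_dist n (row_mean ?U (real_matrix B)) (row_mean ?U Y)
        + vec_dist n (row_mean ?U M) (row_mean ?U Y) + vec_dist n (\<nu> (\<pi> r)) (y r)"
      using vec_dist_triangle[of n "row_mean ?U (real_matrix B)" "y r" "row_mean ?U Y"]
        vec_dist_triangle[of n "row_mean ?U Y" "y r" "row_mean ?U M"]
      by (simp add: \<nu>_def vec_dist_commute)
    also have "\<dots> \<le> 0.03 * \<Delta> + 0.07 * \<Delta> + 0.13 * \<Delta>" by (intro add_mono 1 2 \<nu>\<pi> r)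
    finally show ?thesis using pos by simp
  qed
  moreover have "0 \<le> ctr (\<pi> r) j \<and> ctr (\<pi> r) j \<le> (\<Sum>i\<in>R. real_matrix B i j) / (0.24 * W)"
    if r: "r < k" "j < n" for r j
  proof -
    have eq: "ctr (\<pi> r) j = (\<Sum>i\<in>U (\<pi> r). real_matrix B i j) / real (card (U (\<pi> r)))"
      using ctr \<pi>k[OF r(1)] r(2) by (simp add: U_def row_mean_def)
    have nn: "0 \<le> (\<Sum>i\<in>V. real_matrix B i j)" for V
      by (intro sum_nonneg) (simp add: real_matrix_def)
    have "(\<Sum>i\<in>U (\<pi> r). real_matrix B i j) \<le> (\<Sum>i\<in>R. real_matrix B i j)"
      using R by (intro sum_mono2) (auto simp: U_def label_class_def real_matrix_def)
    then show ?thesis unfolding eq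
      using cardU[OF r(1)] pos nn by (intro conjI divide_nonneg_nonneg frac_le) auto
  qed
  ultimately show ?thesis using that bij by blast
qed

section \<open>Tail bounds\<close>

text \<open>Cauchy-Schwarz in each row makes the supremum one over a bounded set, and homogeneity
  extends it to all \<open>x\<close>. Dropping rows only lowers the left side, so the norm of the
  full matrix serves both halves.\<close>

lemma spectral_norm_bound:
  assumes "finite R'" "R \<subseteq> R'"
  shows "(\<Sum>i\<in>R. (\<Sum>j<n. X i j * x j)\<^sup>2) \<le> (spectral_norm R' n X)\<^sup>2 * (\<Sum>j<n. (x j)\<^sup>2)"
proof -
  define f where "f x = L2_set (\<lambda>i. \<Sum>j<n. X i j * x j) R'" for x
  have bdd: "bdd_above (f ` {x. L2_set x {..<n} \<le> 1})"
  proof (rule bdd_aboveI2)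
    fix x assume x: "x \<in> {x. L2_set x {..<n} \<le> 1}"
    have "f x \<le> (\<Sum>i\<in>R'. \<bar>\<Sum>j<n. X i j * x j\<bar>)" unfolding f_def by (rule L2_set_le_sum_abs)
    also have "\<dots> \<le> (\<Sum>i\<in>R'. L2_set (X i) {..<n})"
    proof (rule sum_mono)
      fix i
      have "\<bar>\<Sum>j<n. X i j * x j\<bar> \<le> (\<Sum>j<n. \<bar>X i j\<bar> * \<bar>x j\<bar>)"
        using sum_abs[of "\<lambda>j. X i j * x j" "{..<n}"] by (simp add: abs_mult)
      also have "\<dots> \<le> L2_set (X i) {..<n} * L2_set x {..<n}" by (rule L2_set_mult_ineq)
      also have "\<dots> \<le> L2_set (X i) {..<n}" using x by (simp add: mult_left_le)
      finally show "\<bar>\<Sum>j<n. X i j * x j\<bar> \<le> L2_set (X i) {..<n}" .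
    qed
    finally show "f x \<le> (\<Sum>i\<in>R'. L2_set (X i) {..<n})" .
  qed
  have "f x \<le> spectral_norm R' n X * L2_set x {..<n}"
  proof (cases "L2_set x {..<n} = 0")
    case True
    then have "\<forall>j<n. x j = 0" by (subst (asm) L2_set_eq_0_iff) auto
    then have "f x = 0" by (simp add: f_def L2_set_def)
    then show ?thesis using True by simp
  next
    case False
    define a where "a = L2_set x {..<n}"
    have a: "a > 0" using False L2_set_nonneg[of x "{..<n}"] unfolding a_def by linarith
    have "L2_set (\<lambda>j. inverse a * x j) {..<n} = 1"
      using a L2_set_right_distrib[of "inverse a" x "{..<n}"] by (simp add: a_def)
    then have "f (\<lambda>j. inverse a * x j) \<le> spectral_norm R' n X"
      unfolding spectral_norm_def f_def[symmetric] by (intro cSUP_upper bdd) simp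
    moreover have "f (\<lambda>j. inverse a * x j) = inverse a * f x"
      using a unfolding f_def by (subst L2_set_right_distrib) (simp_all add: sum_distrib_left mult_ac)
    ultimately show ?thesis using a by (simp add: a_def field_simps)
  qed
  then have "(f x)\<^sup>2 \<le> (spectral_norm R' n X * L2_set x {..<n})\<^sup>2"
    by (intro power_mono) (simp_all add: f_def)
  moreover have "(\<Sum>i\<in>R. (\<Sum>j<n. X i j * x j)\<^sup>2) \<le> (f x)\<^sup>2"
    unfolding f_def L2_set_def using assms by (simp add: sum_nonneg sum_mono2)
  ultimately show ?thesis by (simp add: power_mult_distrib L2_set_def sum_nonneg)
qed

lemma mean_matrix_mixture_data:
  assumes "i < m" "j < n" "0 \<le> \<mu> (c i) j" "\<mu> (c i) j \<le> 1"
  shows "mean_matrix (mixture_data m n c \<mu>) i j = \<mu> (c i) j"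
proof -
  have "map_pmf (\<lambda>x. x j) (map_pmf (\<lambda>A. A i) (mixture_data m n c \<mu>)) = bernoulli_pmf (\<mu> (c i) j)"
    using assms by (simp add: mixture_data_def row_dist_def Pi_pmf_component)
  then have "map_pmf (\<lambda>A. A i j) (mixture_data m n c \<mu>) = bernoulli_pmf (\<mu> (c i) j)"
    by (simp add: pmf.map_comp o_def)
  moreover have "mean_matrix (mixture_data m n c \<mu>) i j
      = measure_pmf.expectation (map_pmf (\<lambda>A. A i j) (mixture_data m n c \<mu>)) of_bool"
    by (simp add: mean_matrix_def real_matrix_def)
  ultimately show ?thesis using assms by simp
qed

section \<open>Exponential moments and Chernoff bounds\<close>

lemma Pi_pmf_chernoff:
  fixes f :: "'i \<Rightarrow> 'b \<Rightarrow> real"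
  assumes I: "finite I"
    and int: "\<And>i. i \<in> I \<Longrightarrow> integrable (measure_pmf (p i)) (\<lambda>x. exp (f i x))"
    and mgf: "\<And>i. i \<in> I \<Longrightarrow> measure_pmf.expectation (p i) (\<lambda>x. exp (f i x)) \<le> exp (s i)"
  shows "measure_pmf.prob (Pi_pmf I d p) {x. t \<le> (\<Sum>i\<in>I. f i (x i))} \<le> exp ((\<Sum>i\<in>I. s i) - t)"
proof -
  let ?P = "Pi_pmf I d p"
  have "{x. t \<le> (\<Sum>i\<in>I. f i (x i))} = {x. exp t \<le> (\<Prod>i\<in>I. exp (f i (x i)))}"
    using I by (simp flip: exp_sum)
  then have "measure_pmf.prob ?P {x. t \<le> (\<Sum>i\<in>I. f i (x i))}
      = measure_pmf.prob ?P {x \<in> space ?P. exp t \<le> (\<Prod>i\<in>I. exp (f i (x i)))}" by simp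
  also have "\<dots> \<le> measure_pmf.expectation ?P (\<lambda>x. \<Prod>i\<in>I. exp (f i (x i))) / exp t"
    using I int by (intro integral_Markov_inequality_measure[where A = "{}"] integrable_prod_Pi_pmf)
      (auto intro!: AE_I2 prod_nonneg)
  also have "measure_pmf.expectation ?P (\<lambda>x. \<Prod>i\<in>I. exp (f i (x i)))
      = (\<Prod>i\<in>I. measure_pmf.expectation (p i) (\<lambda>x. exp (f i x)))"
    using I int by (intro expectation_prod_Pi_pmf) auto
  also have "\<dots> \<le> (\<Prod>i\<in>I. exp (s i))"
    using mgf by (intro prod_mono) (auto intro: integral_nonneg_AE)
  also have "\<dots> = exp (\<Sum>i\<in>I. s i)" using I by (simp add: exp_sum)
  finally show ?thesis by (simp add: exp_diff divide_right_mono)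
qed

lemma exp_le_quadratic:
  fixes x :: real
  assumes "\<bar>x\<bar> \<le> 1"
  shows "exp x \<le> 1 + x + x\<^sup>2"
proof (cases "x \<ge> 0")
  case True
  then show ?thesis using exp_bound[of x] assms by simp
next
  case False
  define y where "y = - x"
  have y: "y \<ge> 0" using False by (simp add: y_def)
  \<comment> \<open>It suffices that \<open>1 - y + y^2\<close> times a lower bound for
    \<open>exp y\<close> is at least 1; with the quadratic Taylor polynomial the terms of first
    order cancel.\<close>
  have "1 \<le> 1 + (y\<^sup>2 + y^3 + y^4) / 2" using y by simp
  also have "\<dots> = (1 - y + y\<^sup>2) * (1 + y + y\<^sup>2 / 2)"
    by (simp add: power2_eq_square power3_eq_cube power4_eq_xxxx field_simps)
  also have "\<dots> \<le> (1 - y + y\<^sup>2) * exp y"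
    using exp_lower_Taylor_quadratic[OF y] assms by (intro mult_left_mono) (auto simp: y_def)
  finally show ?thesis by (simp add: y_def exp_minus field_simps)
qed

text \<open>Centering kills the linear term of the quadratic bound, and the variance
  \<open>\<mu> * (1 - \<mu>)\<close> is at most \<open>v\<close>. Having the variance rather than a
  constant in the exponent is what makes the resulting tail bound of Bernstein type.\<close>

lemma bernoulli_centered_mgf:
  assumes "0 \<le> \<mu>" "\<mu> \<le> 1" "\<mu> \<le> v" "\<bar>t\<bar> \<le> 1"
  shows "measure_pmf.expectation (bernoulli_pmf \<mu>) (\<lambda>x. exp (t * (of_bool x - \<mu>))) \<le> exp (v * t\<^sup>2)"
proof -
  have *: "exp (t * a) \<le> 1 + t * a + (t * a)\<^sup>2" if "\<bar>a\<bar> \<le> 1" for a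
    using that assms(4) mult_mono[of "\<bar>t\<bar>" 1 "\<bar>a\<bar>" 1] by (intro exp_le_quadratic) (simp add: abs_mult)
  have "measure_pmf.expectation (bernoulli_pmf \<mu>) (\<lambda>x. exp (t * (of_bool x - \<mu>)))
      = exp (t * (1 - \<mu>)) * \<mu> + exp (t * (- \<mu>)) * (1 - \<mu>)"
    using assms by simp
  also have "\<dots> \<le> (1 + t * (1 - \<mu>) + (t * (1 - \<mu>))\<^sup>2) * \<mu> + (1 + t * (- \<mu>) + (t * (- \<mu>))\<^sup>2) * (1 - \<mu>)"
    using assms by (intro add_mono mult_right_mono *) auto
  also have "\<dots> = 1 + \<mu> * (1 - \<mu>) * t\<^sup>2"
    by (simp add: power2_eq_square algebra_simps)
  also have "\<mu> * (1 - \<mu>) * t\<^sup>2 \<le> v * t\<^sup>2"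
    using assms mult_mono[of \<mu> v "1 - \<mu>" 1] by (intro mult_right_mono) auto
  also have "1 + v * t\<^sup>2 \<le> exp (v * t\<^sup>2)" by simp
  finally show ?thesis by simp
qed

lemma bernoulli_mgf:
  assumes "0 \<le> \<mu>" "\<mu> \<le> 1"
  shows "measure_pmf.expectation (bernoulli_pmf \<mu>) (\<lambda>x. exp (of_bool x)) \<le> exp (2 * \<mu>)"
proof -
  have "measure_pmf.expectation (bernoulli_pmf \<mu>) (\<lambda>x. exp (of_bool x)) = exp 1 * \<mu> + (1 - \<mu>)"
    using assms by simp
  also have "\<dots> \<le> 3 * \<mu> + (1 - \<mu>)"
    using assms exp_le by (intro add_mono mult_right_mono) auto
  also have "\<dots> \<le> exp (2 * \<mu>)" using exp_ge_add_one_self[of "2 * \<mu>"] by linarith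
  finally show ?thesis .
qed

text \<open>Chernoff with parameter 1. The bound on column sums limits the entries of all estimated
  centers.\<close>

lemma column_sum_tail:
  assumes j: "j < n" and \<mu>: "\<And>i. i < m \<Longrightarrow> 0 \<le> \<mu> (c i) j \<and> \<mu> (c i) j \<le> 1 \<and> \<mu> (c i) j \<le> v"
  shows "measure_pmf.prob (mixture_data m n c \<mu>) {A. T \<le> (\<Sum>i<m. real_matrix A i j)}
       \<le> exp (2 * real m * v - T)"
proof -
  have "measure_pmf.prob (Pi_pmf {..<m} (\<lambda>_. False) (\<lambda>i. row_dist n (\<mu> (c i))))
      {A. T \<le> (\<Sum>i<m. (\<lambda>i x. of_bool (x j)) i (A i))} \<le> exp ((\<Sum>i<m. 2 * v) - T)"
  proof (rule Pi_pmf_chernoff)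
    fix i assume i: "i \<in> {..<m}"
    show "integrable (measure_pmf (row_dist n (\<mu> (c i)))) (\<lambda>x. exp (of_bool (x j) :: real))"
      by (rule measure_pmf.integrable_const_bound[of _ "exp 1"]) auto
    have "measure_pmf.expectation (row_dist n (\<mu> (c i))) (\<lambda>x. exp (of_bool (x j) :: real))
       = measure_pmf.expectation (map_pmf (\<lambda>x. x j) (row_dist n (\<mu> (c i)))) (\<lambda>b. exp (of_bool b))"
      by simp
    also have "map_pmf (\<lambda>x. x j) (row_dist n (\<mu> (c i))) = bernoulli_pmf (\<mu> (c i) j)"
      using j by (simp add: row_dist_def Pi_pmf_component)
    also have "measure_pmf.expectation \<dots> (\<lambda>b. exp (of_bool b)) \<le> exp (2 * \<mu> (c i) j)"
      using \<mu> i by (intro bernoulli_mgf) auto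
    also have "\<dots> \<le> exp (2 * v)" using \<mu> i by simp
    finally show "measure_pmf.expectation (row_dist n (\<mu> (c i))) (\<lambda>x. exp (of_bool (x j))) \<le> exp (2 * v)" .
  qed simp
  then show ?thesis by (simp add: mixture_data_def real_matrix_def mult_ac)
qed

text \<open>Expanding the squares, the difference of the squared distances to \<open>\<beta>\<close>
  and \<open>\<alpha>\<close> is \<open>b^2 - a^2\<close> minus twice the inner product of
  \<open>\<beta> - \<alpha>\<close> with the centered row, so an error forces this inner product to
  be large. \<open>H\<close> bounds both the variances and the entries of
  \<open>\<beta> - \<alpha>\<close>.\<close>

lemma assignment_error_tail:
  assumes \<mu>: "\<And>j. j < n \<Longrightarrow> 0 \<le> \<mu> j \<and> \<mu> j \<le> 1 \<and> \<mu> j \<le> H"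
    and \<alpha>: "\<And>j. j < n \<Longrightarrow> 0 \<le> \<alpha> j \<and> \<alpha> j \<le> H" "vec_dist n \<alpha> \<mu> \<le> 0.24 * \<Delta>"
    and \<beta>: "\<And>j. j < n \<Longrightarrow> 0 \<le> \<beta> j \<and> \<beta> j \<le> H" "vec_dist n \<beta> \<mu>' \<le> 0.24 * \<Delta>"
    and sep: "\<Delta> \<le> vec_dist n \<mu> \<mu>'" and pos: "H > 0" "\<Delta> > 0"
  shows "measure_pmf.prob (row_dist n \<mu>)
    {x. vec_dist n (\<lambda>j. of_bool (x j)) \<beta> \<le> vec_dist n (\<lambda>j. of_bool (x j)) \<alpha>} \<le> exp (- \<Delta>\<^sup>2 / (80 * H))"
proof -
  define a where "a = vec_dist n \<alpha> \<mu>"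
  define b where "b = vec_dist n \<beta> \<mu>"
  define g where "g j = \<beta> j - \<alpha> j" for j
  \<comment> \<open>Chernoff bound with parameter \<open>1 / (8 * H)\<close>, which the threshold \<open>t\<close> includes.\<close>
  define t where "t = (b\<^sup>2 - a\<^sup>2) / (16 * H)"
  have a: "0 \<le> a" "a \<le> 0.24 * \<Delta>" using \<alpha> by (auto simp: a_def vec_dist_nonneg)
  have b: "0.76 * \<Delta> \<le> b"
    using sep \<beta>(2) vec_dist_triangle[of n \<mu> \<mu>' \<beta>] vec_dist_commute[of n \<mu> \<beta>]
    by (simp add: b_def)
  have "{x. vec_dist n (\<lambda>j. of_bool (x j)) \<beta> \<le> vec_dist n (\<lambda>j. of_bool (x j)) \<alpha>}
     \<subseteq> {x. t \<le> (\<Sum>j<n. g j / (8 * H) * (of_bool (x j) - \<mu> j))}"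
  proof
    fix x assume "x \<in> {x. vec_dist n (\<lambda>j. of_bool (x j)) \<beta> \<le> vec_dist n (\<lambda>j. of_bool (x j)) \<alpha>}"
    then have "(vec_dist n (\<lambda>j. of_bool (x j)) \<beta>)\<^sup>2 \<le> (vec_dist n (\<lambda>j. of_bool (x j)) \<alpha>)\<^sup>2"
      by (intro power_mono) (auto simp: vec_dist_nonneg)
    moreover have "(vec_dist n (\<lambda>j. of_bool (x j)) \<beta>)\<^sup>2 - b\<^sup>2 - ((vec_dist n (\<lambda>j. of_bool (x j)) \<alpha>)\<^sup>2 - a\<^sup>2)
       = (\<Sum>j<n. - 2 * (g j * (of_bool (x j) - \<mu> j)))"
      unfolding a_def b_def vec_dist_sq sum_subtractf[symmetric]
      by (intro sum.cong refl) (simp add: g_def power2_eq_square algebra_simps)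
    ultimately have "b\<^sup>2 - a\<^sup>2 \<le> 2 * (\<Sum>j<n. g j * (of_bool (x j) - \<mu> j))"
      by (simp add: sum_negf flip: sum_distrib_left)
    then have "t \<le> 2 * (\<Sum>j<n. g j * (of_bool (x j) - \<mu> j)) / (16 * H)"
      using pos unfolding t_def by (intro divide_right_mono) auto
    also have "\<dots> = (\<Sum>j<n. g j * (of_bool (x j) - \<mu> j)) / (8 * H)" by simp
    also have "\<dots> = (\<Sum>j<n. g j / (8 * H) * (of_bool (x j) - \<mu> j))"
      unfolding sum_divide_distrib by (intro sum.cong refl) (rule times_divide_eq_left[symmetric])
    finally show "x \<in> {x. t \<le> (\<Sum>j<n. g j / (8 * H) * (of_bool (x j) - \<mu> j))}" by simp
  qed
  then have "measure_pmf.prob (row_dist n \<mu>)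
      {x. vec_dist n (\<lambda>j. of_bool (x j)) \<beta> \<le> vec_dist n (\<lambda>j. of_bool (x j)) \<alpha>}
    \<le> measure_pmf.prob (row_dist n \<mu>) {x. t \<le> (\<Sum>j<n. g j / (8 * H) * (of_bool (x j) - \<mu> j))}"
    by (intro measure_pmf.finite_measure_mono) auto
  also have "\<dots> \<le> exp ((\<Sum>j<n. H * (g j / (8 * H))\<^sup>2) - t)"
    unfolding row_dist_def
  proof (rule Pi_pmf_chernoff)
    fix j assume "j \<in> {..<n}"
    then have j: "j < n" by simp
    show "integrable (measure_pmf (bernoulli_pmf (\<mu> j))) (\<lambda>x. exp (g j / (8 * H) * (of_bool x - \<mu> j)))"
      by (rule integrable_measure_pmf_finite) simp
    have "\<bar>g j\<bar> \<le> 8 * H" unfolding g_def using \<alpha>(1)[OF j] \<beta>(1)[OF j] by linarith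
    then have "\<bar>g j / (8 * H)\<bar> \<le> 1" using pos by simp
    then show "measure_pmf.expectation (bernoulli_pmf (\<mu> j)) (\<lambda>x. exp (g j / (8 * H) * (of_bool x - \<mu> j)))
        \<le> exp (H * (g j / (8 * H))\<^sup>2)"
      using \<mu>[OF j] bernoulli_centered_mgf by blast
  qed simp
  also have "(\<Sum>j<n. H * (g j / (8 * H))\<^sup>2) = (vec_dist n \<beta> \<alpha>)\<^sup>2 / (64 * H)"
    unfolding vec_dist_sq sum_divide_distrib using pos
    by (intro sum.cong refl) (simp add: g_def power_divide power_mult_distrib power2_eq_square)
  also have "exp ((vec_dist n \<beta> \<alpha>)\<^sup>2 / (64 * H) - t) \<le> exp (- \<Delta>\<^sup>2 / (80 * H))"
  proof -
    have "vec_dist n \<beta> \<alpha> \<le> a + b"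
      using vec_dist_triangle[of n \<beta> \<alpha> \<mu>] by (simp add: a_def b_def vec_dist_commute)
    then have "(vec_dist n \<beta> \<alpha>)\<^sup>2 \<le> (a + b)\<^sup>2" by (intro power_mono) (auto simp: vec_dist_nonneg)
    \<comment> \<open>The right side factors as \<open>(a + b) * (3 * b - 5 * a)\<close>; from
      \<open>a \<le> 0.24 * \<Delta>\<close> and \<open>b \<ge> 0.76 * \<Delta>\<close> the factors
      are at least \<open>0.76 * \<Delta>\<close> and \<open>1.08 * \<Delta>\<close>.\<close>
    moreover have "0.8 * \<Delta>\<^sup>2 \<le> 4 * (b\<^sup>2 - a\<^sup>2) - (a + b)\<^sup>2"
    proof -
      have "0.8 * \<Delta>\<^sup>2 \<le> (0.76 * \<Delta>) * (1.08 * \<Delta>)" by (simp add: power2_eq_square)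
      also have "\<dots> \<le> (a + b) * (3 * b - 5 * a)" using a b pos by (intro mult_mono) auto
      also have "\<dots> = 4 * (b\<^sup>2 - a\<^sup>2) - (a + b)\<^sup>2" by (simp add: power2_eq_square algebra_simps)
      finally show ?thesis .
    qed
    ultimately have "(vec_dist n \<beta> \<alpha>)\<^sup>2 - 4 * (b\<^sup>2 - a\<^sup>2) \<le> - (0.8 * \<Delta>\<^sup>2)" by linarith
    then have "((vec_dist n \<beta> \<alpha>)\<^sup>2 - 4 * (b\<^sup>2 - a\<^sup>2)) / (64 * H) \<le> - (0.8 * \<Delta>\<^sup>2) / (64 * H)"
      using pos by (intro divide_right_mono) auto
    also have "((vec_dist n \<beta> \<alpha>)\<^sup>2 - 4 * (b\<^sup>2 - a\<^sup>2)) / (64 * H) = (vec_dist n \<beta> \<alpha>)\<^sup>2 / (64 * H) - t"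
      using pos by (simp add: t_def diff_divide_distrib)
    also have "- (0.8 * \<Delta>\<^sup>2) / (64 * H) = - \<Delta>\<^sup>2 / (80 * H)" using pos by (simp add: field_simps)
    finally show ?thesis by simp
  qed
  finally show ?thesis by simp
qed

section \<open>Conditioning on all rows but one\<close>

lemma measure_bind_pmf_le:
  assumes "\<And>x. measure_pmf.prob (N x) S \<le> b"
  shows "measure_pmf.prob (bind_pmf M N) S \<le> b"
proof -
  have "b \<ge> 0" using assms[of undefined] measure_nonneg order_trans by blast
  have "emeasure (bind_pmf M N) S = (\<integral>\<^sup>+x. emeasure (N x) S \<partial>M)" by simp
  also have "\<dots> \<le> (\<integral>\<^sup>+x. ennreal b \<partial>M)"
    using assms by (intro nn_integral_mono) (simp add: measure_pmf.emeasure_eq_measure ennreal_leI)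
  also have "\<dots> = ennreal b" by simp
  finally show ?thesis using \<open>b \<ge> 0\<close> by (simp add: measure_pmf.emeasure_eq_measure)
qed

text \<open>By independence the matrix can be drawn by first drawing the other rows and then
  overwriting row \<open>i\<close>; a bound that holds for every fixed remainder holds on
  average.\<close>

lemma mixture_data_resample_row:
  assumes "i < m"
    and "\<And>A. measure_pmf.prob (row_dist n (\<mu> (c i))) {x. A(i := x) \<in> S} \<le> b"
  shows "measure_pmf.prob (mixture_data m n c \<mu>) S \<le> b"
proof -
  define I where "I = {..<m} - {i}"
  have I: "{..<m} = insert i I" "finite I" "i \<notin> I" using assms(1) by (auto simp: I_def)
  have "mixture_data m n c \<mu> = do {A \<leftarrow> Pi_pmf I (\<lambda>_. False) (\<lambda>i. row_dist n (\<mu> (c i)));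
      map_pmf (\<lambda>x. A(i := x)) (row_dist n (\<mu> (c i)))}"
    unfolding mixture_data_def I(1) Pi_pmf_insert'[OF I(2,3)]
    by (subst bind_commute_pmf) (simp add: map_pmf_def)
  then show ?thesis
    using assms(2) by (auto intro!: measure_bind_pmf_le simp: vimage_def)
qed

section \<open>Exact recovery\<close>

text \<open>Collects what \<open>assignment_error_tail\<close> asks of a center.\<close>

definition near_mean :: "nat \<Rightarrow> real \<Rightarrow> real \<Rightarrow> (nat \<Rightarrow> real) \<Rightarrow> (nat \<Rightarrow> real) \<Rightarrow> bool" where
  "near_mean n H \<Delta> y z \<longleftrightarrow> vec_dist n z y \<le> 0.24 * \<Delta> \<and> (\<forall>j<n. 0 \<le> z j \<and> z j \<le> H)"

text \<open>
  The centers carry unknown labels, so the event ranges over all label pairs \<open>a\<close>, \<open>b\<close> instead of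
  referring to a matching of centers and means.
\<close>

definition row_error ::
  "nat \<Rightarrow> nat \<Rightarrow> real \<Rightarrow> real \<Rightarrow> (nat \<Rightarrow> nat \<Rightarrow> real) \<Rightarrow> ((nat \<Rightarrow> nat \<Rightarrow> bool) \<Rightarrow> nat \<Rightarrow> nat \<Rightarrow> real) \<Rightarrow>
   nat \<Rightarrow> nat \<Rightarrow> (nat \<Rightarrow> nat \<Rightarrow> bool) set" where
  "row_error k n H \<Delta> \<mu> ctr r i = {A. \<exists>a<k. \<exists>b<k. \<exists>s<k. s \<noteq> r \<and>
     near_mean n H \<Delta> (\<mu> r) (ctr A a) \<and> near_mean n H \<Delta> (\<mu> s) (ctr A b) \<and>
     vec_dist n (real_matrix A i) (ctr A b) \<le> vec_dist n (real_matrix A i) (ctr A a)}"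

section \<open>The probability of mislabeling one row\<close>

lemma near_mean_cong:
  "(\<And>j. j < n \<Longrightarrow> z j = z' j) \<Longrightarrow> near_mean n H \<Delta> y z \<longleftrightarrow> near_mean n H \<Delta> y z'"
  unfolding near_mean_def using vec_dist_cong[of n z z' y y] by auto

text \<open>Since \<open>i \<notin> R\<close>, overwriting row \<open>i\<close> leaves the centers
  computed from \<open>R\<close> unchanged, so they are constants while the row is random. A union
  bound over label pairs gives the factor \<open>k^2\<close>.\<close>

lemma row_error_prob:
  assumes i: "i < m" "i \<notin> R" "c i < k" and ctr: "centers_procedure k n centers"
    and \<mu>: "\<And>r j. r < k \<Longrightarrow> j < n \<Longrightarrow> 0 \<le> \<mu> r j \<and> \<mu> r j \<le> 1 \<and> \<mu> r j \<le> H"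
    and sep: "\<And>r s. r < k \<Longrightarrow> s < k \<Longrightarrow> r \<noteq> s \<Longrightarrow> \<Delta> \<le> vec_dist n (\<mu> r) (\<mu> s)"
    and pos: "H > 0" "\<Delta> > 0"
  shows "measure_pmf.prob (mixture_data m n c \<mu>) (row_error k n H \<Delta> \<mu> (centers R) (c i) i)
       \<le> (real k)\<^sup>2 * exp (- \<Delta>\<^sup>2 / (80 * H))"
proof (rule mixture_data_resample_row[OF i(1)])
  fix A :: "nat \<Rightarrow> nat \<Rightarrow> bool"
  define z where "z = centers R A"
  have eq: "centers R (A(i := x)) a j = z a j" if "a < k" "j < n" for x a j
  proof -
    have "\<forall>i'\<in>R. \<forall>j<n. (A(i := x)) i' j = A i' j" using i(2) by auto
    moreover have "\<forall>R B B'. (\<forall>i\<in>R. \<forall>j<n. B i j = B' i j) \<longrightarrow>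
        (\<forall>r<k. \<forall>j<n. centers R B r j = centers R B' r j)"
      using ctr by (simp add: centers_procedure_def)
    ultimately have "\<forall>r<k. \<forall>j<n. centers R (A(i := x)) r j = centers R A r j"
      by (elim allE[where x = R] allE[where x = "A(i := x)"] allE[where x = A] impE) assumption+
    then show ?thesis using that by (simp add: z_def)
  qed
  \<comment> \<open>The label \<open>s\<close> only decides whether the event is empty, so it stays
    inside \<open>T\<close> and the union runs over pairs instead of triples.\<close>
  define T where "T a b = (if near_mean n H \<Delta> (\<mu> (c i)) (z a) \<and>
      (\<exists>s<k. s \<noteq> c i \<and> near_mean n H \<Delta> (\<mu> s) (z b))
    then {x. vec_dist n (\<lambda>j. of_bool (x j)) (z b) \<le> vec_dist n (\<lambda>j. of_bool (x j)) (z a)} else {})"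
    for a b
  let ?P = "measure_pmf.prob (row_dist n (\<mu> (c i)))"
  have T: "?P (T a b) \<le> exp (- \<Delta>\<^sup>2 / (80 * H))" for a b
  proof (cases "near_mean n H \<Delta> (\<mu> (c i)) (z a) \<and> (\<exists>s<k. s \<noteq> c i \<and> near_mean n H \<Delta> (\<mu> s) (z b))")
    case True
    then obtain s where s: "s < k" "s \<noteq> c i" "near_mean n H \<Delta> (\<mu> s) (z b)" by blast
    show ?thesis unfolding T_def if_P[OF True]
      by (rule assignment_error_tail[where \<mu>' = "\<mu> s"])
        (use True s \<mu>[OF i(3)] sep[of "c i" s] i(3) pos in \<open>auto simp: near_mean_def\<close>)
  qed (auto simp: T_def)
  have "{x. A(i := x) \<in> row_error k n H \<Delta> \<mu> (centers R) (c i) i} \<subseteq> (\<Union>(a, b)\<in>{..<k} \<times> {..<k}. T a b)"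
  proof
    fix x assume "x \<in> {x. A(i := x) \<in> row_error k n H \<Delta> \<mu> (centers R) (c i) i}"
    then obtain a b s where ab: "a < k" "b < k" "s < k" "s \<noteq> c i"
      "near_mean n H \<Delta> (\<mu> (c i)) (centers R (A(i := x)) a)"
      "near_mean n H \<Delta> (\<mu> s) (centers R (A(i := x)) b)"
      "vec_dist n (real_matrix (A(i := x)) i) (centers R (A(i := x)) b)
        \<le> vec_dist n (real_matrix (A(i := x)) i) (centers R (A(i := x)) a)"
      unfolding row_error_def by blast
    have "vec_dist n (real_matrix (A(i := x)) i) (centers R (A(i := x)) a)
        = vec_dist n (\<lambda>j. of_bool (x j)) (z a)" if "a < k" for a
      using eq[OF that] by (intro vec_dist_cong) (auto simp: real_matrix_def)
    then have "x \<in> T a b"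
      using ab near_mean_cong[of n "centers R (A(i := x)) a" "z a", OF eq[OF ab(1)]]
        near_mean_cong[of n "centers R (A(i := x)) b" "z b", OF eq[OF ab(2)]]
      by (auto simp: T_def)
    then show "x \<in> (\<Union>(a, b)\<in>{..<k} \<times> {..<k}. T a b)" using ab by auto
  qed
  then have "?P {x. A(i := x) \<in> row_error k n H \<Delta> \<mu> (centers R) (c i) i}
      \<le> ?P (\<Union>(a, b)\<in>{..<k} \<times> {..<k}. T a b)"
    by (intro measure_pmf.finite_measure_mono) auto
  also have "\<dots> \<le> (\<Sum>(a, b)\<in>{..<k} \<times> {..<k}. ?P (T a b))"
    using measure_UNION_le[of "{..<k} \<times> {..<k}" "\<lambda>(a, b). T a b" "row_dist n (\<mu> (c i))"]
    by (simp add: case_prod_beta')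
  also have "\<dots> \<le> (\<Sum>(a, b)\<in>{..<k} \<times> {..<k}. exp (- \<Delta>\<^sup>2 / (80 * H)))"
    using T by (intro sum_mono) auto
  also have "\<dots> = (real k)\<^sup>2 * exp (- \<Delta>\<^sup>2 / (80 * H))"
    by (simp add: power2_eq_square)
  finally show "?P {x. A(i := x) \<in> row_error k n H \<Delta> \<mu> (centers R) (c i) i}
      \<le> (real k)\<^sup>2 * exp (- \<Delta>\<^sup>2 / (80 * H))" .
qed

section \<open>Correctness of the algorithm outside the error events\<close>

lemma assignment_eq:
  assumes i: "i \<in> S" "r < k" and asg: "is_assignment k n S A (ctr A) lab"
    and \<pi>: "bij_betw \<pi> {..<k} {..<k}" "\<And>r. r < k \<Longrightarrow> near_mean n H \<Delta> (\<mu> r) (ctr A (\<pi> r))"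
    and no_error: "A \<notin> row_error k n H \<Delta> \<mu> ctr r i"
  shows "lab i = \<pi> r"
proof (rule ccontr)
  assume ne: "lab i \<noteq> \<pi> r"
  have \<pi>r: "\<pi> r < k" using \<pi>(1) i(2) by (auto simp: bij_betw_def)
  have lab: "lab i < k"
    "vec_dist n (real_matrix A i) (ctr A (lab i)) \<le> vec_dist n (real_matrix A i) (ctr A (\<pi> r))"
    using asg i(1) \<pi>r unfolding is_assignment_def is_arg_min_linorder by auto
  obtain s where s: "s < k" "lab i = \<pi> s" using \<pi>(1) lab(1) by (auto simp: bij_betw_def)
  have "s \<noteq> r" using s ne by auto
  \<comment> \<open>The event is defined with a non-strict inequality, so it also covers ties,
    however the minimizer is chosen.\<close>
  then have "A \<in> row_error k n H \<Delta> \<mu> ctr r i"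
    unfolding row_error_def using s(1) lab \<pi>r \<pi>(2)[OF i(2)] \<pi>(2)[OF s(1)] s(2) by auto
  then show False using no_error by simp
qed

text \<open>A wrong match would bring two distinct means within
  \<open>4 * 0.24 * \<Delta> = 0.96 * \<Delta>\<close> of each other.\<close>

lemma matching_eq:
  assumes match: "is_matching k n z z' \<tau>" and r: "r < k" and pos: "\<Delta> > 0"
    and \<pi>: "bij_betw \<pi> {..<k} {..<k}" "\<And>r. r < k \<Longrightarrow> near_mean n H \<Delta> (\<mu> r) (z (\<pi> r))"
    and \<pi>': "bij_betw \<pi>' {..<k} {..<k}" "\<And>r. r < k \<Longrightarrow> near_mean n H \<Delta> (\<mu> r) (z' (\<pi>' r))"
    and sep: "\<And>r s. r < k \<Longrightarrow> s < k \<Longrightarrow> r \<noteq> s \<Longrightarrow> \<Delta> \<le> vec_dist n (\<mu> r) (\<mu> s)"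
  shows "\<tau> (\<pi> r) = \<pi>' r"
proof -
  have \<pi>r: "\<pi> r < k" "\<pi>' r < k" using \<pi>(1) \<pi>'(1) r by (auto simp: bij_betw_def)
  have \<tau>: "\<tau> (\<pi> r) < k" "vec_dist n (z (\<pi> r)) (z' (\<tau> (\<pi> r))) \<le> vec_dist n (z (\<pi> r)) (z' (\<pi>' r))"
    using match \<pi>r unfolding is_matching_def is_arg_min_linorder by auto
  obtain s where s: "s < k" "\<tau> (\<pi> r) = \<pi>' s" using \<pi>'(1) \<tau>(1) by (auto simp: bij_betw_def)
  have near: "vec_dist n (z (\<pi> r)) (\<mu> r) \<le> 0.24 * \<Delta>" "vec_dist n (z' (\<pi>' r)) (\<mu> r) \<le> 0.24 * \<Delta>"
    "vec_dist n (z' (\<pi>' s)) (\<mu> s) \<le> 0.24 * \<Delta>"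
    using \<pi>(2) \<pi>'(2) r s(1) by (auto simp: near_mean_def)
  have "s = r"
  proof (rule ccontr)
    assume "s \<noteq> r"
    then have "\<Delta> \<le> vec_dist n (\<mu> r) (\<mu> s)" using r s by (intro sep) auto
    also have "\<dots> \<le> vec_dist n (\<mu> r) (z (\<pi> r)) + vec_dist n (z (\<pi> r)) (z' (\<pi>' s)) + vec_dist n (z' (\<pi>' s)) (\<mu> s)"
      using vec_dist_triangle[of n "\<mu> r" "\<mu> s" "z (\<pi> r)"]
        vec_dist_triangle[of n "z (\<pi> r)" "\<mu> s" "z' (\<pi>' s)"] by simp
    also have "\<dots> \<le> vec_dist n (\<mu> r) (z (\<pi> r))
        + (vec_dist n (z (\<pi> r)) (\<mu> r) + vec_dist n (\<mu> r) (z' (\<pi>' r))) + vec_dist n (z' (\<pi>' s)) (\<mu> s)"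
      using \<tau>(2) s(2) vec_dist_triangle[of n "z (\<pi> r)" "z' (\<pi>' r)" "\<mu> r"] by simp
    also have "\<dots> \<le> 0.96 * \<Delta>"
      using near vec_dist_commute[of n "\<mu> r" "z (\<pi> r)"] vec_dist_commute[of n "\<mu> r" "z' (\<pi>' r)"]
      by simp
    finally show False using pos by simp
  qed
  then show ?thesis using s by simp
qed

text \<open>Applies \<open>centers_close\<close> to one half. Noise and column sums of the half are
  dominated by those of the full matrix, and \<open>0.24 * W\<close> bounds the estimated class
  sizes from below, so \<open>col\<close> turns into the entry bound \<open>H\<close>.\<close>

lemma centers_near_means:
  assumes S: "S \<subseteq> {..<m}" and ctr: "is_centers k n S A ctr"
    and c: "\<And>i. i < m \<Longrightarrow> c i < k"
    and \<mu>: "\<And>r j. r < k \<Longrightarrow> j < n \<Longrightarrow> 0 \<le> \<mu> r j \<and> \<mu> r j \<le> 1"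
    and pos: "W > 0" "\<Delta> > 0" "k > 0"
    and spec: "real k * (spectral_norm {..<m} n
             (\<lambda>i j. real_matrix A i j - mean_matrix (mixture_data m n c \<mu>) i j))\<^sup>2 \<le> 0.0002 * W * \<Delta>\<^sup>2"
    and card: "\<And>r. r < k \<Longrightarrow> W / 4 \<le> real (card (cluster m c r \<inter> S))"
    and sep: "\<And>r s. r < k \<Longrightarrow> s < k \<Longrightarrow> r \<noteq> s \<Longrightarrow> \<Delta> \<le> vec_dist n (\<mu> r) (\<mu> s)"
    and col: "\<And>j. j < n \<Longrightarrow> (\<Sum>i<m. real_matrix A i j) \<le> 0.24 * W * H"
  shows "\<exists>\<pi>. bij_betw \<pi> {..<k} {..<k} \<and> (\<forall>r<k. near_mean n H \<Delta> (\<mu> r) (ctr (\<pi> r)))"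
proof -
  have fS: "finite S" using S finite_subset by blast
  define e2 where "e2 = (spectral_norm {..<m} n
    (\<lambda>i j. real_matrix A i j - mean_matrix (mixture_data m n c \<mu>) i j))\<^sup>2"
  have noise: "(\<Sum>i\<in>S. (\<Sum>j<n. (real_matrix A i j - \<mu> (c i) j) * x j)\<^sup>2) \<le> e2 * (\<Sum>j<n. (x j)\<^sup>2)" for x
  proof -
    have "(\<Sum>i\<in>S. (\<Sum>j<n. (real_matrix A i j - \<mu> (c i) j) * x j)\<^sup>2)
      = (\<Sum>i\<in>S. (\<Sum>j<n. (real_matrix A i j - mean_matrix (mixture_data m n c \<mu>) i j) * x j)\<^sup>2)"
    proof (intro sum.cong refl arg_cong[where f = "\<lambda>t. t\<^sup>2"])
      fix i j assume "i \<in> S" "j \<in> {..<n}"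
      then have "i < m" "j < n" "c i < k" using S c by auto
      then show "(real_matrix A i j - \<mu> (c i) j) * x j
        = (real_matrix A i j - mean_matrix (mixture_data m n c \<mu>) i j) * x j"
        using \<mu> by (simp add: mean_matrix_mixture_data)
    qed
    then show ?thesis
      unfolding e2_def using spectral_norm_bound[OF finite_lessThan S] by simp
  qed
  have class_eq: "label_class S c r = cluster m c r \<inter> S" for r
    using S by (auto simp: label_class_def cluster_def)
  obtain \<pi> where \<pi>: "bij_betw \<pi> {..<k} {..<k}"
    "\<And>r. r < k \<Longrightarrow> vec_dist n (ctr (\<pi> r)) (\<mu> r) \<le> 0.24 * \<Delta>"
    "\<And>r j. r < k \<Longrightarrow> j < n \<Longrightarrow>
       0 \<le> ctr (\<pi> r) j \<and> ctr (\<pi> r) j \<le> (\<Sum>i\<in>S. real_matrix A i j) / (0.24 * W)"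
    by (rule centers_close[where c = c and y = \<mu> and ?e2.0 = e2, OF fS ctr _ noise _ _ pos _ sep])
      (use spec card S c in \<open>auto simp: e2_def class_eq\<close>)
  have "near_mean n H \<Delta> (\<mu> r) (ctr (\<pi> r))" if r: "r < k" for r
    unfolding near_mean_def
  proof (intro conjI allI impI)
    fix j assume j: "j < n"
    show "0 \<le> ctr (\<pi> r) j" using \<pi>(3)[OF r j] by simp
    have "(\<Sum>i\<in>S. real_matrix A i j) \<le> (\<Sum>i<m. real_matrix A i j)"
      using S by (intro sum_mono2) (auto simp: real_matrix_def)
    also have "\<dots> \<le> 0.24 * W * H" by (rule col[OF j])
    finally have "(\<Sum>i\<in>S. real_matrix A i j) / (0.24 * W) \<le> H" using pos by (simp add: field_simps)
    then show "ctr (\<pi> r) j \<le> H" using \<pi>(3)[OF r j] by simp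
  qed (rule \<pi>(2)[OF r])
  then show ?thesis using \<pi>(1) by blast
qed

text \<open>The permutation of the output is that of the centers of \<open>S\<^sub>2\<close>: rows
  of \<open>S\<^sub>1\<close> receive these labels directly, while rows of \<open>S\<^sub>2\<close>
  receive labels of the other centers, which \<open>\<tau>\<close> translates.\<close>

lemma clustering_correct:
  assumes split: "S\<^sub>1 \<union> S\<^sub>2 = {..<m}" and ctr: "centers_procedure k n centers"
    and c: "\<And>i. i < m \<Longrightarrow> c i < k"
    and \<mu>: "\<And>r j. r < k \<Longrightarrow> j < n \<Longrightarrow> 0 \<le> \<mu> r j \<and> \<mu> r j \<le> 1"
    and pos: "W > 0" "\<Delta> > 0" "k > 0"
    and spec: "real k * (spectral_norm {..<m} n
             (\<lambda>i j. real_matrix A i j - mean_matrix (mixture_data m n c \<mu>) i j))\<^sup>2 \<le> 0.0002 * W * \<Delta>\<^sup>2"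
    and card: "\<And>r. r < k \<Longrightarrow> W / 4 \<le> real (card (cluster m c r \<inter> S\<^sub>1))"
      "\<And>r. r < k \<Longrightarrow> W / 4 \<le> real (card (cluster m c r \<inter> S\<^sub>2))"
    and sep: "\<And>r s. r < k \<Longrightarrow> s < k \<Longrightarrow> r \<noteq> s \<Longrightarrow> \<Delta> \<le> vec_dist n (\<mu> r) (\<mu> s)"
    and col: "\<And>j. j < n \<Longrightarrow> (\<Sum>i<m. real_matrix A i j) \<le> 0.24 * W * H"
    and no_error: "\<And>i. i \<in> S\<^sub>1 \<Longrightarrow> A \<notin> row_error k n H \<Delta> \<mu> (centers S\<^sub>2) (c i) i"
      "\<And>i. i \<in> S\<^sub>2 \<Longrightarrow> A \<notin> row_error k n H \<Delta> \<mu> (centers S\<^sub>1) (c i) i"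
    and out: "clustering_output k n centers S\<^sub>1 S\<^sub>2 A out"
  shows "equal_up_to_perm k m out c"
proof -
  have S: "S\<^sub>1 \<subseteq> {..<m}" "S\<^sub>2 \<subseteq> {..<m}" using split by auto
  have fS: "finite S\<^sub>1" "finite S\<^sub>2" using S finite_subset by blast+
  have is_ctr: "is_centers k n S\<^sub>1 A (centers S\<^sub>1 A)" "is_centers k n S\<^sub>2 A (centers S\<^sub>2 A)"
    using ctr fS unfolding centers_procedure_def by auto
  have "\<exists>\<pi>. bij_betw \<pi> {..<k} {..<k} \<and> (\<forall>r<k. near_mean n H \<Delta> (\<mu> r) (centers S\<^sub>1 A (\<pi> r)))"
    by (rule centers_near_means[OF S(1) is_ctr(1) c \<mu> pos spec card(1) sep col])
  then obtain \<pi>1 where \<pi>1: "bij_betw \<pi>1 {..<k} {..<k}"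
    "\<And>r. r < k \<Longrightarrow> near_mean n H \<Delta> (\<mu> r) (centers S\<^sub>1 A (\<pi>1 r))"
    by blast
  have "\<exists>\<pi>. bij_betw \<pi> {..<k} {..<k} \<and> (\<forall>r<k. near_mean n H \<Delta> (\<mu> r) (centers S\<^sub>2 A (\<pi> r)))"
    by (rule centers_near_means[OF S(2) is_ctr(2) c \<mu> pos spec card(2) sep col])
  then obtain \<pi>2 where \<pi>2: "bij_betw \<pi>2 {..<k} {..<k}"
    "\<And>r. r < k \<Longrightarrow> near_mean n H \<Delta> (\<mu> r) (centers S\<^sub>2 A (\<pi>2 r))"
    by blast
  obtain lab1 lab2 \<tau> where
    asg: "is_assignment k n S\<^sub>2 A (centers S\<^sub>1 A) lab2" "is_assignment k n S\<^sub>1 A (centers S\<^sub>2 A) lab1"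
    and match: "is_matching k n (centers S\<^sub>1 A) (centers S\<^sub>2 A) \<tau>"
    and out: "\<And>i. i \<in> S\<^sub>1 \<Longrightarrow> out i = lab1 i" "\<And>i. i \<in> S\<^sub>2 \<Longrightarrow> out i = \<tau> (lab2 i)"
    using out unfolding clustering_output_def by (elim exE conjE) (rule that, assumption+, simp_all)
  have "out i = \<pi>2 (c i)" if "i < m" for i
  proof -
    have "i \<in> S\<^sub>1 \<union> S\<^sub>2" using that by (simp add: split)
    then consider "i \<in> S\<^sub>1" | "i \<in> S\<^sub>2" by blast
    then show ?thesis
    proof cases
      case 1
      then show ?thesis
        using assignment_eq[where ctr = "centers S\<^sub>2", OF 1 c[OF that] asg(2) \<pi>2 no_error(1)[OF 1]] out
        by simp
    next
      case 2
      then show ?thesis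
        using assignment_eq[where ctr = "centers S\<^sub>1", OF 2 c[OF that] asg(1) \<pi>1 no_error(2)[OF 2]]
          matching_eq[OF match c[OF that] pos(2) \<pi>1 \<pi>2 sep] out by simp
    qed
  qed
  then show ?thesis unfolding equal_up_to_perm_def using \<pi>2(1) by blast
qed

text \<open>With a single label every assignment and every matching is forced to be 0.\<close>

lemma clustering_output_single_cluster:
  assumes "S\<^sub>1 \<union> S\<^sub>2 = {..<m}" "\<And>i. i < m \<Longrightarrow> c i < 1" "clustering_output 1 n centers S\<^sub>1 S\<^sub>2 A out"
  shows "equal_up_to_perm 1 m out c"
proof -
  obtain lab1 lab2 \<tau> where
    asg: "is_assignment 1 n S\<^sub>2 A (centers S\<^sub>1 A) lab2" "is_assignment 1 n S\<^sub>1 A (centers S\<^sub>2 A) lab1"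
    and match: "is_matching 1 n (centers S\<^sub>1 A) (centers S\<^sub>2 A) \<tau>"
    and out: "\<And>i. i \<in> S\<^sub>1 \<Longrightarrow> out i = lab1 i" "\<And>i. i \<in> S\<^sub>2 \<Longrightarrow> out i = \<tau> (lab2 i)"
    using assms(3) unfolding clustering_output_def by blast
  have "out i = 0" if "i < m" for i
  proof -
    have "i \<in> S\<^sub>1 \<union> S\<^sub>2" using that by (simp add: assms(1))
    then show ?thesis using asg match out
      unfolding is_assignment_def is_matching_def is_arg_min_def by auto
  qed
  then show ?thesis
    unfolding equal_up_to_perm_def using assms(2) by (intro exI[of _ id]) auto
qed

section \<open>Parameters of the mixture and the final union bound\<close>

lemma separation_le:
  assumes "r < k" "s < k" "r \<noteq> s"
  shows "separation k n \<mu> \<le> vec_dist n (\<mu> r) (\<mu> s)"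
  unfolding separation_def
proof (rule Min_le)
  have "{vec_dist n (\<mu> r) (\<mu> s) |r s. r < k \<and> s < k \<and> r \<noteq> s}
      \<subseteq> (\<lambda>(r, s). vec_dist n (\<mu> r) (\<mu> s)) ` ({..<k} \<times> {..<k})" by auto
  then show "finite {vec_dist n (\<mu> r) (\<mu> s) |r s. r < k \<and> s < k \<and> r \<noteq> s}"
    by (rule finite_subset) auto
qed (use assms in blast)

lemma min_weight_bounds:
  assumes "k > 0" "\<And>r. r < k \<Longrightarrow> 0 < weight m c r"
  shows "0 < min_weight k m c" "min_weight k m c \<le> 1" "\<And>r. r < k \<Longrightarrow> min_weight k m c \<le> weight m c r"
proof -
  show le: "min_weight k m c \<le> weight m c r" if "r < k" for r
    unfolding min_weight_def using that by (intro Min_le) auto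
  show "0 < min_weight k m c"
    unfolding min_weight_def using assms by (subst Min_gr_iff) auto
  have "card (cluster m c 0) \<le> card {..<m}"
    by (intro card_mono) (auto simp: cluster_def)
  then have "weight m c 0 \<le> 1" by (simp add: weight_def divide_le_eq)
  then show "min_weight k m c \<le> 1" using le[OF assms(1)] by simp
qed

text \<open>Every label occurs among the rows. This absorbs the factor \<open>k^2\<close> of the
  union bound into a power of the dimensions.\<close>

lemma number_of_clusters_le:
  assumes "\<And>r. r < k \<Longrightarrow> 0 < weight m c r"
  shows "k \<le> m"
proof -
  have "{..<k} \<subseteq> c ` {..<m}"
  proof
    fix r assume "r \<in> {..<k}"
    then have "0 < weight m c r" using assms by simp
    then have "cluster m c r \<noteq> {}" by (intro notI) (simp add: weight_def)
    then show "r \<in> c ` {..<m}" by (auto simp: cluster_def)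
  qed
  then have "card {..<k} \<le> card (c ` {..<m})" by (intro card_mono) auto
  also have "\<dots> \<le> card {..<m}" by (rule card_image_le) simp
  finally show ?thesis by simp
qed

text \<open>Failure forces a large column sum or a row error. In \<open>large\<close>, one logarithm
  comes from the entry bound \<open>H\<close> of the centers and the other from the exponent needed
  for a polynomially small row error.\<close>

lemma clustering_failure_prob:
  fixes C c\<^sub>0 \<sigma>2 \<Delta> :: real
  defines "Q \<equiv> 5 * (2 + (C + 1) / c\<^sub>0)"
  assumes C: "C > 0" "c\<^sub>0 > 0" and dim: "1 \<le> k" "1 \<le> m" "1 \<le> n"
    and c: "\<And>i. i < m \<Longrightarrow> c i < k" and wt: "\<And>r. r < k \<Longrightarrow> 0 < weight m c r"
    and \<mu>: "\<And>r j. r < k \<Longrightarrow> j < n \<Longrightarrow> 0 \<le> \<mu> r j \<and> \<mu> r j \<le> 1 \<and> \<mu> r j \<le> \<sigma>2"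
    and \<sigma>2: "0 < \<sigma>2" "c\<^sub>0 \<le> real m * \<sigma>2" and \<Delta>: "\<Delta> > 0"
    and sep: "\<And>r s. r < k \<Longrightarrow> s < k \<Longrightarrow> r \<noteq> s \<Longrightarrow> \<Delta> \<le> vec_dist n (\<mu> r) (\<mu> s)"
    and large: "80 * Q * (C + 3) * (ln (real (m + n + 1)))\<^sup>2 * (\<sigma>2 / min_weight k m c) \<le> \<Delta>\<^sup>2"
    and split: "equal_split m S\<^sub>1 S\<^sub>2" "representative_split k m c S\<^sub>1 S\<^sub>2"
    and ctr: "centers_procedure k n centers"
  shows "measure_pmf.prob (mixture_data m n c \<mu>)
      {A. (spectral_norm {..<m} n
             (\<lambda>i j. real_matrix A i j - mean_matrix (mixture_data m n c \<mu>) i j))\<^sup>2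
            \<le> 0.01 * min_weight k m c * real m * \<Delta>\<^sup>2 / (50 * real k) \<and>
          (\<exists>out. clustering_output k n centers S\<^sub>1 S\<^sub>2 A out \<and> \<not> equal_up_to_perm k m out c)}
      \<le> 2 * real m powr (- C)" (is "measure_pmf.prob _ ?E \<le> _")
proof -
  let ?P = "measure_pmf.prob (mixture_data m n c \<mu>)"
  define w where "w = min_weight k m c"
  define N where "N = real (m + n + 1)"
  define lg where "lg = ln N"
  define H where "H = Q * lg * \<sigma>2 / w"
  \<comment> \<open>The excess \<open>(C + 1) * lg\<close> makes one column fail with probability at
    most \<open>N powr (- (C + 1))\<close>, which leaves room for a union over the columns.\<close>
  define T where "T = 2 * real m * \<sigma>2 + (C + 1) * lg"
  \<comment> \<open>A row is labeled by the centers of the half that does not contain it.\<close>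
  define other where "other i = (if i \<in> S\<^sub>1 then S\<^sub>2 else S\<^sub>1)" for i
  define Col where "Col j = {A. T \<le> (\<Sum>i<m. real_matrix A i j)}" for j
  define Row where "Row i = row_error k n H \<Delta> \<mu> (centers (other i)) (c i) i" for i
  have w: "0 < w" "w \<le> 1" "\<And>r. r < k \<Longrightarrow> w \<le> weight m c r"
    using min_weight_bounds[of k m c] dim wt by (auto simp: w_def)
  have N: "3 \<le> N" "real m \<le> N" "real n \<le> N" using dim by (auto simp: N_def)
  have "exp 1 \<le> N" using exp_le N(1) by linarith
  then have lg: "1 \<le> lg" using N(1) by (simp add: lg_def ln_ge_iff)
  have Q: "10 \<le> Q" using C by (simp add: Q_def)
  have H\<sigma>: "\<sigma>2 \<le> H"
  proof -
    have "1 * 1 * \<sigma>2 \<le> Q * lg * \<sigma>2" using Q lg \<sigma>2 by (intro mult_right_mono mult_mono) auto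
    also have "\<dots> \<le> H" using w Q lg \<sigma>2 unfolding H_def
      by (simp add: pos_le_divide_eq mult_left_le)
    finally show ?thesis by simp
  qed
  then have H: "H > 0" using \<sigma>2 by simp
  \<comment> \<open>Here \<open>lg \<ge> 1\<close> absorbs the first term of \<open>T\<close>, and
    \<open>c\<^sub>0 \<le> m * \<sigma>2\<close> turns the second into a multiple of
    \<open>m * \<sigma>2 * lg\<close>. The factor 5 in \<open>Q\<close> offsets \<open>0.24\<close>,
    with \<open>1.2\<close> to spare.\<close>
  have TH: "T \<le> 0.24 * (w * real m) * H"
  proof -
    have 1: "2 * real m * \<sigma>2 \<le> (2 * real m * \<sigma>2) * lg" using mult_left_mono[OF lg, of "2 * real m * \<sigma>2"] \<sigma>2 by simp
    have "(C + 1) * lg = c\<^sub>0 * ((C + 1) / c\<^sub>0 * lg)" using C by simp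
    also have "\<dots> \<le> (real m * \<sigma>2) * ((C + 1) / c\<^sub>0 * lg)" using C lg \<sigma>2 by (intro mult_right_mono) auto
    finally have "T \<le> real m * \<sigma>2 * lg * (2 + (C + 1) / c\<^sub>0)"
      using 1 unfolding T_def by (simp add: algebra_simps)
    also have "\<dots> \<le> 1.2 * (real m * \<sigma>2 * lg * (2 + (C + 1) / c\<^sub>0))"
      using C lg \<sigma>2 by simp
    also have "\<dots> = 0.24 * (w * real m) * H" using w by (simp add: H_def Q_def)
    finally show ?thesis .
  qed
  have S: "S\<^sub>1 \<union> S\<^sub>2 = {..<m}" "S\<^sub>1 \<inter> S\<^sub>2 = {}" using split(1) by (auto simp: equal_split_def)
  have half: "w * real m / 4 \<le> real (card (cluster m c r \<inter> S\<^sub>1))"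
    "w * real m / 4 \<le> real (card (cluster m c r \<inter> S\<^sub>2))" if r: "r < k" for r
  proof -
    have "w * real m \<le> real (card (cluster m c r))"
      using w(3)[OF r] dim by (simp add: weight_def field_simps)
    then show "w * real m / 4 \<le> real (card (cluster m c r \<inter> S\<^sub>1))"
      "w * real m / 4 \<le> real (card (cluster m c r \<inter> S\<^sub>2))"
      using split(2) r unfolding representative_split_def by force+
  qed
  have incl: "?E \<subseteq> (\<Union>j\<in>{..<n}. Col j) \<union> (\<Union>i\<in>{..<m}. Row i)"
  proof
    fix A assume A: "A \<in> ?E"
    then obtain out where out: "clustering_output k n centers S\<^sub>1 S\<^sub>2 A out" "\<not> equal_up_to_perm k m out c"
      by blast
    have spec: "real k * (spectral_norm {..<m} n
        (\<lambda>i j. real_matrix A i j - mean_matrix (mixture_data m n c \<mu>) i j))\<^sup>2 \<le> 0.0002 * (w * real m) * \<Delta>\<^sup>2"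
      using A dim by (simp add: w_def field_simps)
    show "A \<in> (\<Union>j\<in>{..<n}. Col j) \<union> (\<Union>i\<in>{..<m}. Row i)"
    proof (rule ccontr)
      assume no: "\<not> ?thesis"
      have col: "(\<Sum>i<m. real_matrix A i j) \<le> 0.24 * (w * real m) * H" if "j < n" for j
        using no that TH by (force simp: Col_def)
      have row: "A \<notin> row_error k n H \<Delta> \<mu> (centers S\<^sub>2) (c i) i" if "i \<in> S\<^sub>1" for i
      proof -
        have "i < m" "other i = S\<^sub>2" using that S by (auto simp: other_def)
        then show ?thesis using no by (auto simp: Row_def)
      qed
      have row': "A \<notin> row_error k n H \<Delta> \<mu> (centers S\<^sub>1) (c i) i" if "i \<in> S\<^sub>2" for i
      proof -
        have "i < m" "other i = S\<^sub>1" using that S by (auto simp: other_def)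
        then show ?thesis using no by (auto simp: Row_def)
      qed
      have "equal_up_to_perm k m out c"
        by (rule clustering_correct[OF S(1) ctr c _ _ \<Delta> _ spec half sep col row row' out(1)])
          (use \<mu> w dim in auto)
      then show False using out(2) by simp
    qed
  qed
  have exp_lg: "exp (- (x * lg)) = N powr (- x)" for x
    using N by (simp add: powr_def lg_def)
  have Col: "?P (Col j) \<le> N powr (- (C + 1))" if "j < n" for j
  proof -
    have "?P (Col j) \<le> exp (2 * real m * \<sigma>2 - T)"
      unfolding Col_def by (rule column_sum_tail[OF that]) (use \<mu> c that in auto)
    also have "2 * real m * \<sigma>2 - T = - ((C + 1) * lg)" by (simp add: T_def)
    finally show ?thesis unfolding exp_lg .
  qed
  \<comment> \<open>With \<open>k \<le> N\<close>, the exponent \<open>C + 3\<close> pays for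
    \<open>k^2\<close> and for the later sum over at most \<open>N\<close> rows.\<close>
  have Row: "?P (Row i) \<le> N\<^sup>2 * N powr (- (C + 3))" if i: "i < m" for i
  proof -
    have "i \<notin> other i" using S i by (auto simp: other_def)
    then have "?P (Row i) \<le> (real k)\<^sup>2 * exp (- \<Delta>\<^sup>2 / (80 * H))"
      unfolding Row_def using \<mu> H\<sigma> by (intro row_error_prob i c ctr sep H \<Delta>) force+
    also have "\<dots> \<le> N\<^sup>2 * N powr (- (C + 3))"
    proof (intro mult_mono power_mono)
      show "real k \<le> N" using number_of_clusters_le[of k m c] wt N by simp
      have "(C + 3) * lg * (80 * H) = 80 * Q * (C + 3) * lg\<^sup>2 * (\<sigma>2 / w)"
        by (simp add: H_def power2_eq_square)
      also have "\<dots> \<le> \<Delta>\<^sup>2" using large by (simp add: lg_def N_def w_def)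
      finally have "(C + 3) * lg \<le> \<Delta>\<^sup>2 / (80 * H)" using H by (simp add: pos_le_divide_eq)
      then show "exp (- \<Delta>\<^sup>2 / (80 * H)) \<le> N powr (- (C + 3))" unfolding exp_lg[symmetric] by simp
    qed auto
    finally show ?thesis .
  qed
  have "?P ?E \<le> ?P ((\<Union>j\<in>{..<n}. Col j) \<union> (\<Union>i\<in>{..<m}. Row i))"
    using incl by (intro measure_pmf.finite_measure_mono) auto
  also have "\<dots> \<le> ?P (\<Union>j\<in>{..<n}. Col j) + ?P (\<Union>i\<in>{..<m}. Row i)"
    by (rule measure_Un_le) auto
  also have "\<dots> \<le> (\<Sum>j<n. ?P (Col j)) + (\<Sum>i<m. ?P (Row i))"
    by (intro add_mono measure_UNION_le) auto
  also have "\<dots> \<le> (\<Sum>j<n. N powr (- (C + 1))) + (\<Sum>i<m. N\<^sup>2 * N powr (- (C + 3)))"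
    using Col Row by (intro add_mono sum_mono) auto
  also have "\<dots> \<le> N * N powr (- (C + 1)) + N * (N\<^sup>2 * N powr (- (C + 3)))"
    using N by (simp add: add_mono mult_right_mono)
  also have "\<dots> = 2 * N powr (- C)"
  proof -
    have "N * N powr (- (C + 1)) = N powr (- C)" using N by (simp add: powr_mult_base)
    moreover have "N * (N\<^sup>2 * N powr (- (C + 3))) = N powr (- C)"
    proof -
      have "N * (N\<^sup>2 * N powr (- (C + 3))) = N powr 3 * N powr (- (C + 3))"
        using N by (simp add: powr_numeral power2_eq_square power3_eq_cube)
      then show ?thesis by (simp flip: powr_add)
    qed
    ultimately show ?thesis by simp
  qed
  also have "\<dots> \<le> 2 * real m powr (- C)"
    using N dim C by (intro mult_left_mono powr_mono2') auto
  finally show ?thesis .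
qed

theorem theorem1:
  fixes C c\<^sub>0 :: real
  assumes "C > 0" and "c\<^sub>0 > 0"
  shows "\<exists>K>0. \<forall>(k::nat) (m::nat) (n::nat) (c :: nat \<Rightarrow> nat) (\<mu> :: nat \<Rightarrow> nat \<Rightarrow> real)
      (\<sigma>2::real) (\<Delta>::real) S\<^sub>1 S\<^sub>2 centers.
    1 \<le> k \<and> 1 \<le> m \<and> 1 \<le> n \<and>
    (\<forall>i<m. c i < k) \<and> (\<forall>r<k. 0 < weight m c r) \<and>
    (\<forall>r<k. \<forall>j<n. 0 \<le> \<mu> r j \<and> \<mu> r j \<le> 1) \<and>
    0 < \<sigma>2 \<and> (\<forall>r<k. \<forall>j<n. \<mu> r j \<le> \<sigma>2) \<and>
    (2 \<le> k \<longrightarrow> \<Delta> = separation k n \<mu>) \<and>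
    c\<^sub>0 \<le> real m * \<sigma>2 \<and>
    K * ln (real (m + n + 1)) powr K * sqrt (\<sigma>2 / min_weight k m c) \<le> \<Delta> \<and>
    equal_split m S\<^sub>1 S\<^sub>2 \<and> representative_split k m c S\<^sub>1 S\<^sub>2 \<and>
    centers_procedure k n centers
    \<longrightarrow>
    measure_pmf.prob (mixture_data m n c \<mu>)
      {A. (spectral_norm {..<m} n
             (\<lambda>i j. real_matrix A i j - mean_matrix (mixture_data m n c \<mu>) i j))\<^sup>2
            \<le> 0.01 * min_weight k m c * real m * \<Delta>\<^sup>2 / (50 * real k) \<and>
          (\<exists>out. clustering_output k n centers S\<^sub>1 S\<^sub>2 A out \<and> \<not> equal_up_to_perm k m out c)}
      \<le> K * real m powr (- C)"
proof -
  define Q where "Q = 5 * (2 + (C + 1) / c\<^sub>0)"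
  \<comment> \<open>One constant serves as separation factor, as exponent of the logarithm and as
    factor of the probability. It suffices that \<open>K\<close> is the constant of
    \<open>large\<close> in \<open>clustering_failure_prob\<close> and at least 2.\<close>
  define K where "K = 80 * Q * (C + 3)"
  have Q: "10 \<le> Q" using assms by (simp add: Q_def)
  have "80 * 10 * 3 \<le> K" unfolding K_def using Q assms by (intro mult_mono) auto
  then have K: "2 \<le> K" by simp
  show ?thesis
  proof (intro exI[of _ K] conjI allI impI, goal_cases)
    case 1
    show ?case using K by simp
  next
    case (2 k m n c \<mu> \<sigma>2 \<Delta> S\<^sub>1 S\<^sub>2 centers)
    then have dim: "1 \<le> k" "1 \<le> m" "1 \<le> n"
      and c: "\<And>i. i < m \<Longrightarrow> c i < k" and wt: "\<And>r. r < k \<Longrightarrow> 0 < weight m c r"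
      and \<mu>: "\<And>r j. r < k \<Longrightarrow> j < n \<Longrightarrow> 0 \<le> \<mu> r j \<and> \<mu> r j \<le> 1 \<and> \<mu> r j \<le> \<sigma>2"
      and \<sigma>2: "0 < \<sigma>2" "c\<^sub>0 \<le> real m * \<sigma>2" and \<Delta>: "2 \<le> k \<Longrightarrow> \<Delta> = separation k n \<mu>"
      and large: "K * ln (real (m + n + 1)) powr K * sqrt (\<sigma>2 / min_weight k m c) \<le> \<Delta>"
      and split: "equal_split m S\<^sub>1 S\<^sub>2" "representative_split k m c S\<^sub>1 S\<^sub>2"
      and ctr: "centers_procedure k n centers"
      by simp_all
    let ?P = "measure_pmf.prob (mixture_data m n c \<mu>)"
    let ?E = "{A. (spectral_norm {..<m} n
             (\<lambda>i j. real_matrix A i j - mean_matrix (mixture_data m n c \<mu>) i j))\<^sup>2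
            \<le> 0.01 * min_weight k m c * real m * \<Delta>\<^sup>2 / (50 * real k) \<and>
          (\<exists>out. clustering_output k n centers S\<^sub>1 S\<^sub>2 A out \<and> \<not> equal_up_to_perm k m out c)}"
    show ?case
    proof (cases "k = 1")
      case True
      have "?E = {}"
        using clustering_output_single_cluster[of S\<^sub>1 S\<^sub>2 m c n centers] c split(1)
        unfolding True equal_split_def by blast
      then have "?P ?E = 0" by (simp only: measure_empty)
      also have "0 \<le> K * real m powr (- C)" using K by simp
      finally show ?thesis .
    next
      case False
      define w where "w = min_weight k m c"
      define lg where "lg = ln (real (m + n + 1))"
      have w: "0 < w" using min_weight_bounds(1)[of k m c] dim wt by (simp add: w_def)
      have "exp 1 \<le> real (m + n + 1)" using exp_le dim by linarith
      then have lg: "1 \<le> lg" using dim by (simp add: lg_def ln_ge_iff)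
      have "lg powr 1 \<le> lg powr K" using K lg by (intro powr_mono) auto
      then have lgK: "lg \<le> lg powr K" using lg by simp
      have "K * lg * sqrt (\<sigma>2 / w) \<le> K * lg powr K * sqrt (\<sigma>2 / w)"
        using K lgK w \<sigma>2 by (intro mult_right_mono mult_left_mono) auto
      also have "\<dots> \<le> \<Delta>" using large by (simp add: lg_def w_def)
      finally have \<Delta>': "K * lg * sqrt (\<sigma>2 / w) \<le> \<Delta>" .
      have "0 < K * lg * sqrt (\<sigma>2 / w)" using K lg w \<sigma>2 by simp
      then have pos: "\<Delta> > 0" using \<Delta>' by linarith
      \<comment> \<open>The separation enters squared, and \<open>K \<le> K^2\<close> recovers the
        form required by \<open>large\<close>.\<close>
      have "K * lg\<^sup>2 * (\<sigma>2 / w) \<le> K\<^sup>2 * lg\<^sup>2 * (\<sigma>2 / w)"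
        using K lg w \<sigma>2 by (intro mult_right_mono) (auto simp: power2_eq_square)
      also have "\<dots> = (K * lg * sqrt (\<sigma>2 / w))\<^sup>2"
        using w \<sigma>2 by (simp add: power_mult_distrib)
      also have "\<dots> \<le> \<Delta>\<^sup>2"
        using \<Delta>' K lg w \<sigma>2 by (intro power_mono) auto
      finally have "?P ?E \<le> 2 * real m powr (- C)"
        using separation_le[of _ k _ n \<mu>] \<Delta> False dim
        by (intro clustering_failure_prob[OF assms dim c wt \<mu> \<sigma>2 pos _ _ split ctr])
          (auto simp: K_def Q_def lg_def w_def)
      also have "\<dots> \<le> K * real m powr (- C)" using K by (intro mult_right_mono) auto
      finally show ?thesis .
    qed
  qed
qed

end
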